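(* Let $\Omega=[0,1]^D$, let $(A\mu)_m=\int_\Omega a_m\,d\mu$ with $a_m\in\mathcal{C}^2(\Omega)$ vanishing on the boundary ($1\le m\le M$), and let $f:\mathbb{R}^M\to\mathbb{R}$ be convex and differentiable with $L$-Lipschitz gradient. Assume that $\mathcal{J}(\mu)=\|\mu\|_{\mathcal{M}}+f(A\mu)$ is coercive ($\mathcal{J}(\mu)\to\infty$ when $\|\mu\|_{\mathcal{M}}\to\infty$) and that the non-degenerate source condition (defined in the context) holds, with $\mu^\star=\sum_{s=1}^S\alpha_s^\star\delta_{x_s^\star}$ the unique solution of $(\mathcal{P}(\Omega))$, $X^\star=\{x_1^\star,\dots,x_S^\star\}$, and $q^\star$ the solution of $(\mathcal{D}(\Omega))$. Consider the adaptive refinement algorithm (described in the context) with target precision $J\in\mathbb{N}$, and assume that its candidate cells satisfy, for every $k$: (a) $X_k\subset\bigcup_{\omega\in\Omega_k^\star}\omega$, where $X_k$ is the set of local maximizers $x\in\Omega$ of $|A^*q_k|$ with $|A^*q_k(x)|\ge 1$; (b) $\|A^*q_k\|_{L^\infty(\omega)}\ge 1-\kappa|\omega|^2$ for every $\omega\in\Omega_k^\star$, with a constant $\kappa>0$ independent of $k$ and $\omega$. Then the algorithm eventually converges linearly: there exist constants $k_0\in\mathbb{N}$ and $c>0$ (depending on $A$, $f$ and $\mu^\star$, not on $J$) such that the algorithm terminates in no more than $k_0+cSJ$ iterations. Moreover, for $J$ sufficiently large, the index $k$ at which the algorithm terminates satisfies $$|\mathcal{V}_k|=O(J),\qquad \operatorname{dist}_{\mathcal{H}}(X^\star\,|\,\operatorname{vert}(\Omega_k^\star))\lesssim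 2^{-J},\qquad \|q_k-q^\star\|_2\lesssim 2^{-J},\qquad \mathcal{J}(\mu_k)-\mathcal{J}(\mu^\star)\lesssim 2^{-2J},$$ where the implied constants do not depend on $J$.
   Context: $\mathcal{M}(\Omega)$ is the space of Radon measures of bounded total variation on $\Omega$ with total variation norm $\|\cdot\|_{\mathcal{M}}$; for $\mathcal{V}\subseteq\Omega$, $\mathcal{M}(\mathcal{V})$ is the set of measures supported on $\mathcal{V}$. $A^*q=\sum_{m=1}^M q_m a_m$, $\|A^*q\|_{L^\infty(\mathcal{V})}=\sup_{x\in\mathcal{V}}|A^*q(x)|$, $f^*$ is the Fenchel conjugate of $f$. Problems: $(\mathcal{P}(\mathcal{V}))$: $\inf_{\mu\in\mathcal{M}(\mathcal{V})}\mathcal{J}(\mu)$. $(\mathcal{D}(\mathcal{V}))$: $\sup\{-f^*(q): q\in\mathbb{R}^M,\ \|A^*q\|_{L^\infty(\mathcal{V})}\le 1\}$. Distances: $\operatorname{dist}(x,X)=\inf_{y\in X}\|x-y\|_2$ and $\operatorname{dist}_{\mathcal{H}}(X_1|X_2)=\sup_{x_2\in X_2}\inf_{x_1\in X_1}\|x_1-x_2\|_2$. Non-degenerate source condition: (1) the solution $\mu^\star$ of $(\mathcal{P}(\Omega))$ is unique and supported on $S\in\mathbb{N}$ points, $\mu^\star=\sum_{s=1}^S\alpha_s^\star\delta_{x_s^\star}$ with $x_s^\star\in\Omega$ and real weights $\alpha_s^\star$; (2) for the dual solution $q^\star$, $|A^*q^\star|$ equals $1$ only at $x_1^\star,\dots,x_S^\star$,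 and there exist $\gamma>0$, $R>0$ such that the balls $B(x_s^\star,R)$ are pairwise disjoint, $\operatorname{sign}(A^*q^\star(x))\,(A^*q^\star)''(x)\preccurlyeq-\gamma\,\mathrm{Id}$ for all $x\in\Omega$ with $\operatorname{dist}(x,X^\star)\le R$, and $|A^*q^\star(x)|\le 1-\frac{\gamma R^2}{2}$ for all $x\in\Omega$ with $\operatorname{dist}(x,X^\star)\ge R$. Cells: a dyadic cell is a set $\omega=x+2^{-j}[0,1]^D$ with $j\ge 0$ an integer and $x\in(2^{-j}\{0,1,\dots,2^j-1\})^D$; $|\omega|=2^{-j}$ is its edge-length and $\operatorname{vert}(\omega)$ its set of vertices. For a collection $\mathcal{W}$ of cells, $\operatorname{vert}(\mathcal{W})=\bigcup_{\omega\in\mathcal{W}}\operatorname{vert}(\omega)$. A cell partition is a finite collection of cells whose union is $\Omega$ and such that two distinct cells have an intersection of zero Lebesgue measure. Adaptive refinement algorithm with target precision $J$: start from a cell partition $\Omega_0$ (e.g. $\{\Omega\}$). At step $k$, let $\mathcal{V}_k=\operatorname{vert}(\Omega_k)$; let $\mu_k$ be a solution of $(\mathcal{P}(\mathcal{V}_k))$ and $q_k$ a solution of $(\mathcal{D}(\mathcal{V}_k))$; determine a set of candidate cells $\Omega_k^\star\subset\Omega_k$. If $\max_{\omega\in\Omega_k^\star}|\omega|<2^{-J}$, terminate and output $(\mu_k,q_k)$; otherwise obtain $\Omega_{k+1}$ from $\Omega_k$ by subdividing each cell of $\Omega_k^\star$ of largest diameter (among the cells of $\Omega_k^\star$) into $2^D$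 equal cells, and pass to step $k+1$. The value of $J$ influences only when the algorithm stops: runs with different $J$ are truncations of one and the same sequence. *)

theory Defs
  imports "HOL-Analysis.Analysis"
begin

section \<open>Signed measures\<close>

text \<open>A signed Radon measure is represented by its values on the Borel sets of the ambient
  space; the value \<open>0\<close> on all other sets makes equality of representations the same as
  equality of measures. Regularity is automatic for finite Borel measures on a Euclidean space.\<close>

type_synonym 'd smeasure = "(real ^ 'd) set \<Rightarrow> real"

definition variation_sums :: "('d::finite) smeasure \<Rightarrow> real set" where
  "variation_sums \<mu> =
     {(\<Sum>E\<in>P. \<bar>\<mu> E\<bar>) | P. finite P \<and> P \<subseteq> sets borel \<and> disjoint P}"

definition tv_norm :: "('d::finite) smeasure \<Rightarrow> real" where
  "tv_norm \<mu> = Sup (variation_sums \<mu>)"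

definition signed_measure :: "('d::finite) smeasure \<Rightarrow> bool" where
  "signed_measure \<mu> \<longleftrightarrow>
     (\<forall>E. E \<notin> sets borel \<longrightarrow> \<mu> E = 0) \<and>
     \<mu> {} = 0 \<and>
     (\<forall>F :: nat \<Rightarrow> (real ^ 'd) set. range F \<subseteq> sets borel \<longrightarrow> disjoint_family F \<longrightarrow>
        (\<lambda>n. \<mu> (F n)) sums \<mu> (\<Union>n. F n)) \<and>
     bdd_above (variation_sums \<mu>)"

text \<open>The space $\mathcal{M}(V)$, for closed \<open>V\<close>.\<close>

definition measures_on :: "(real ^ 'd::finite) set \<Rightarrow> 'd smeasure set" where
  "measures_on V = {\<mu>. signed_measure \<mu> \<and> (\<forall>E\<in>sets borel. E \<inter> V = {} \<longrightarrow> \<mu> E = 0)}"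

definition dirac_comb ::
    "nat \<Rightarrow> (nat \<Rightarrow> real) \<Rightarrow> (nat \<Rightarrow> real ^ 'd) \<Rightarrow> ('d::finite) smeasure" where
  "dirac_comb S \<alpha> x =
     (\<lambda>E. if E \<in> sets borel then (\<Sum>s\<in>{1..S}. \<alpha> s * indicator E (x s)) else 0)"

text \<open>Jordan decomposition: the upper and lower variation. The coercion \<open>ennreal\<close> maps negative
  values to \<open>0\<close>, which does not affect the supremum since \<open>B = {}\<close> is admitted.\<close>

definition upper_variation :: "('d::finite) smeasure \<Rightarrow> (real ^ 'd) measure" where
  "upper_variation \<mu> = measure_of UNIV (sets borel)
     (\<lambda>E. SUP B\<in>{B \<in> sets borel. B \<subseteq> E}. ennreal (\<mu> B))"

definition lower_variation :: "('d::finite) smeasure \<Rightarrow> (real ^ 'd) measure" where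
  "lower_variation \<mu> = upper_variation (\<lambda>E. - \<mu> E)"

definition signed_integral ::
    "(real ^ 'd::finite) set \<Rightarrow> (real ^ 'd \<Rightarrow> real) \<Rightarrow> 'd smeasure \<Rightarrow> real" where
  "signed_integral X g \<mu> =
     (LINT x:X|upper_variation \<mu>. g x) - (LINT x:X|lower_variation \<mu>. g x)"

section \<open>Twice continuously differentiable functions on a closed cube\<close>

text \<open>Derivatives are taken within the set \<open>X\<close>, so that they also make sense on its boundary.
  When \<open>X\<close> is a nondegenerate closed box they are unique, and the class below consists of the functions
  whose derivatives up to order two extend continuously from the interior to \<open>X\<close>.\<close>

definition partial ::
    "(real ^ 'd::finite) set \<Rightarrow> 'd \<Rightarrow> (real ^ 'd \<Rightarrow> real) \<Rightarrow> real ^ 'd \<Rightarrow> real" where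
  "partial X i g x = frechet_derivative g (at x within X) (axis i 1)"

definition C2_on :: "(real ^ 'd::finite) set \<Rightarrow> (real ^ 'd \<Rightarrow> real) \<Rightarrow> bool" where
  "C2_on X g \<longleftrightarrow>
     g differentiable_on X \<and>
     (\<forall>i. partial X i g differentiable_on X) \<and>
     (\<forall>i j. continuous_on X (partial X i (partial X j g)))"

definition hessian ::
    "(real ^ 'd::finite) set \<Rightarrow> (real ^ 'd \<Rightarrow> real) \<Rightarrow> real ^ 'd \<Rightarrow> real ^ 'd ^ 'd" where
  "hessian X g x = (\<chi> i j. partial X i (partial X j g) x)"

definition loewner_le :: "real ^ 'd ^ 'd \<Rightarrow> real ^ 'd ^ 'd::finite \<Rightarrow> bool" where
  "loewner_le A B \<longleftrightarrow> (\<forall>h. h \<bullet> (A *v h) \<le> h \<bullet> (B *v h))"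

section \<open>The primal and dual problems\<close>

definition Cube :: "(real ^ 'd::finite) set" where
  "Cube = cbox 0 (\<chi> i. 1)"

definition A_op :: "('m::finite \<Rightarrow> real ^ 'd \<Rightarrow> real) \<Rightarrow> ('d::finite) smeasure \<Rightarrow> real ^ 'm" where
  "A_op a \<mu> = (\<chi> m. signed_integral Cube (a m) \<mu>)"

definition A_adj :: "('m::finite \<Rightarrow> real ^ 'd::finite \<Rightarrow> real) \<Rightarrow> real ^ 'm \<Rightarrow> real ^ 'd \<Rightarrow> real" where
  "A_adj a q x = (\<Sum>m\<in>UNIV. q $ m * a m x)"

definition sup_norm :: "(real ^ 'd::finite) set \<Rightarrow> (real ^ 'd \<Rightarrow> real) \<Rightarrow> real" where
  "sup_norm V g = (SUP x\<in>V. \<bar>g x\<bar>)"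

definition objective ::
    "('m::finite \<Rightarrow> real ^ 'd \<Rightarrow> real) \<Rightarrow> (real ^ 'm \<Rightarrow> real) \<Rightarrow> ('d::finite) smeasure \<Rightarrow> real" where
  "objective a f \<mu> = tv_norm \<mu> + f (A_op a \<mu>)"

definition coercive_objective ::
    "('m::finite \<Rightarrow> real ^ 'd::finite \<Rightarrow> real) \<Rightarrow> (real ^ 'm \<Rightarrow> real) \<Rightarrow> bool" where
  "coercive_objective a f \<longleftrightarrow>
     (\<forall>C. \<exists>r. \<forall>\<mu>\<in>measures_on Cube. r \<le> tv_norm \<mu> \<longrightarrow> C \<le> objective a f \<mu>)"

definition fenchel_conjugate :: "(real ^ 'm::finite \<Rightarrow> real) \<Rightarrow> real ^ 'm \<Rightarrow> ereal" where
  "fenchel_conjugate f q = (SUP y. ereal (q \<bullet> y - f y))"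

definition primal_solution ::
    "('m::finite \<Rightarrow> real ^ 'd \<Rightarrow> real) \<Rightarrow> (real ^ 'm \<Rightarrow> real) \<Rightarrow> (real ^ 'd) set \<Rightarrow>
     ('d::finite) smeasure \<Rightarrow> bool" where
  "primal_solution a f V \<mu> \<longleftrightarrow>
     \<mu> \<in> measures_on V \<and> (\<forall>\<nu>\<in>measures_on V. objective a f \<mu> \<le> objective a f \<nu>)"

definition dual_solution ::
    "('m::finite \<Rightarrow> real ^ 'd::finite \<Rightarrow> real) \<Rightarrow> (real ^ 'm \<Rightarrow> real) \<Rightarrow> (real ^ 'd) set \<Rightarrow>
     real ^ 'm \<Rightarrow> bool" where
  "dual_solution a f V q \<longleftrightarrow>
     sup_norm V (A_adj a q) \<le> 1 \<and>
     (\<forall>p. sup_norm V (A_adj a p) \<le> 1 \<longrightarrow> - fenchel_conjugate f p \<le> - fenchel_conjugate f q)"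

section \<open>Distances and the non-degenerate source condition\<close>

text \<open>Extended reals are used so that the infimum over the empty set is \<open>\<infinity>\<close>
  (whereas \<open>infdist x {} = 0\<close>).\<close>

definition dist_to :: "real ^ 'd::finite \<Rightarrow> (real ^ 'd) set \<Rightarrow> ereal" where
  "dist_to x X = (INF y\<in>X. ereal (norm (x - y)))"

definition dist_H :: "(real ^ 'd::finite) set \<Rightarrow> (real ^ 'd) set \<Rightarrow> ereal" where
  "dist_H X1 X2 = (SUP x2\<in>X2. INF x1\<in>X1. ereal (norm (x1 - x2)))"

definition nondegenerate_source_condition ::
    "('m::finite \<Rightarrow> real ^ 'd::finite \<Rightarrow> real) \<Rightarrow> (real ^ 'm \<Rightarrow> real) \<Rightarrow>
     nat \<Rightarrow> (nat \<Rightarrow> real) \<Rightarrow> (nat \<Rightarrow> real ^ 'd) \<Rightarrow> real ^ 'm \<Rightarrow> bool" where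
  "nondegenerate_source_condition a f S \<alpha> x q \<longleftrightarrow>
     (\<forall>s\<in>{1..S}. x s \<in> Cube) \<and>
     primal_solution a f Cube (dirac_comb S \<alpha> x) \<and>
     (\<forall>\<nu>. primal_solution a f Cube \<nu> \<longrightarrow> \<nu> = dirac_comb S \<alpha> x) \<and>
     dual_solution a f Cube q \<and>
     {y \<in> Cube. \<bar>A_adj a q y\<bar> = 1} \<subseteq> x ` {1..S} \<and>
     (\<exists>\<gamma>>0. \<exists>R>0.
        disjoint_family_on (\<lambda>s. ball (x s) R) {1..S} \<and>
        (\<forall>y\<in>Cube. dist_to y (x ` {1..S}) \<le> ereal R \<longrightarrow>
           loewner_le (sgn (A_adj a q y) *\<^sub>R hessian Cube (A_adj a q) y) (- \<gamma> *\<^sub>R mat 1)) \<and>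
        (\<forall>y\<in>Cube. ereal R \<le> dist_to y (x ` {1..S}) \<longrightarrow>
           \<bar>A_adj a q y\<bar> \<le> 1 - \<gamma> * R\<^sup>2 / 2))"

section \<open>Dyadic cells\<close>

text \<open>The pair \<open>(j, n)\<close> encodes the cell $2^{-j} n + 2^{-j} [0,1]^D$; distinct pairs
  encode distinct cells.\<close>

type_synonym 'd cell = "nat \<times> (nat ^ 'd)"

definition dyadic_cell :: "('d::finite) cell \<Rightarrow> bool" where
  "dyadic_cell = (\<lambda>(j, n). \<forall>i. n $ i < 2 ^ j)"

definition edge :: "('d::finite) cell \<Rightarrow> real" where
  "edge \<omega> = 1 / 2 ^ fst \<omega>"

definition corner :: "('d::finite) cell \<Rightarrow> real ^ 'd" where
  "corner \<omega> = (\<chi> i. edge \<omega> * real (snd \<omega> $ i))"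

definition cell_set :: "('d::finite) cell \<Rightarrow> (real ^ 'd) set" where
  "cell_set \<omega> = (\<lambda>y. corner \<omega> + edge \<omega> *\<^sub>R y) ` Cube"

definition cell_vert :: "('d::finite) cell \<Rightarrow> (real ^ 'd) set" where
  "cell_vert \<omega> = (\<lambda>y. corner \<omega> + edge \<omega> *\<^sub>R y) ` {y. \<forall>i. y $ i \<in> {0, 1}}"

definition vert :: "('d::finite) cell set \<Rightarrow> (real ^ 'd) set" where
  "vert W = (\<Union>\<omega>\<in>W. cell_vert \<omega>)"

definition cell_partition :: "('d::finite) cell set \<Rightarrow> bool" where
  "cell_partition W \<longleftrightarrow>
     finite W \<and> (\<forall>\<omega>\<in>W. dyadic_cell \<omega>) \<and> (\<Union>\<omega>\<in>W. cell_set \<omega>) = Cube \<and>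
     pairwise (\<lambda>\<omega> \<omega>'. negligible (cell_set \<omega> \<inter> cell_set \<omega>')) W"

definition children :: "('d::finite) cell \<Rightarrow> 'd cell set" where
  "children \<omega> = {(Suc (fst \<omega>), \<chi> i. 2 * snd \<omega> $ i + b i) | b. \<forall>i. b i \<in> {0, 1}}"

section \<open>The adaptive refinement algorithm\<close>

definition largest_cells :: "('d::finite) cell set \<Rightarrow> 'd cell set" where
  "largest_cells W =
     {\<omega> \<in> W. \<forall>\<omega>'\<in>W. diameter (cell_set \<omega>') \<le> diameter (cell_set \<omega>)}"

definition refine :: "('d::finite) cell set \<Rightarrow> 'd cell set \<Rightarrow> 'd cell set" where
  "refine W C = (W - largest_cells C) \<union> (\<Union>\<omega>\<in>largest_cells C. children \<omega>)"

text \<open>The untruncated sequence of iterates, which does not involve the target precision: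
  \<open>\<Omega> k\<close> are the partitions and \<open>C k\<close> the sets of candidate cells.\<close>

definition adaptive_run ::
    "('m::finite \<Rightarrow> real ^ 'd::finite \<Rightarrow> real) \<Rightarrow> (real ^ 'm \<Rightarrow> real) \<Rightarrow>
     (nat \<Rightarrow> 'd cell set) \<Rightarrow> (nat \<Rightarrow> 'd cell set) \<Rightarrow>
     (nat \<Rightarrow> 'd smeasure) \<Rightarrow> (nat \<Rightarrow> real ^ 'm) \<Rightarrow> bool" where
  "adaptive_run a f \<Omega> C \<mu> q \<longleftrightarrow>
     cell_partition (\<Omega> 0) \<and>
     (\<forall>k. primal_solution a f (vert (\<Omega> k)) (\<mu> k) \<and>
          dual_solution a f (vert (\<Omega> k)) (q k) \<and>
          C k \<subseteq> \<Omega> k \<and>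
          \<Omega> (Suc k) = refine (\<Omega> k) (C k))"

text \<open>Stopping criterion for target precision \<open>J\<close>; it is met if there are no candidates.\<close>

definition stops :: "(nat \<Rightarrow> ('d::finite) cell set) \<Rightarrow> nat \<Rightarrow> nat \<Rightarrow> bool" where
  "stops C J k \<longleftrightarrow> (\<forall>\<omega>\<in>C k. edge \<omega> < 1 / 2 ^ J)"

definition terminates_at :: "(nat \<Rightarrow> ('d::finite) cell set) \<Rightarrow> nat \<Rightarrow> nat \<Rightarrow> bool" where
  "terminates_at C J k \<longleftrightarrow> stops C J k \<and> (\<forall>i<k. \<not> stops C J i)"

definition big_local_maximizers :: "(real ^ 'd::finite \<Rightarrow> real) \<Rightarrow> (real ^ 'd) set" where
  "big_local_maximizers g =
     {x \<in> Cube. 1 \<le> \<bar>g x\<bar> \<and> (\<forall>\<^sub>F y in at x within Cube. \<bar>g y\<bar> \<le> \<bar>g x\<bar>)}"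

definition admissible_candidates ::
    "('m::finite \<Rightarrow> real ^ 'd::finite \<Rightarrow> real) \<Rightarrow> real \<Rightarrow>
     (nat \<Rightarrow> 'd cell set) \<Rightarrow> (nat \<Rightarrow> real ^ 'm) \<Rightarrow> bool" where
  "admissible_candidates a \<kappa> C q \<longleftrightarrow>
     (\<forall>k. big_local_maximizers (A_adj a (q k)) \<subseteq> (\<Union>\<omega>\<in>C k. cell_set \<omega>) \<and>
          (\<forall>\<omega>\<in>C k. 1 - \<kappa> * (edge \<omega>)\<^sup>2 \<le> sup_norm (cell_set \<omega>) (A_adj a (q k))))"

end

theory Submission
  imports Defs
begin

text \<open>
  The argument compares the certificate \<open>A_adj a (q k)\<close> of an iterate with the limiting certificate
  \<open>A_adj a qstar\<close> at the scale of the largest candidate cells. Let these have edge length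
  \<open>e = 2 ^ -j\<close>.

  \<^emph>\<open>Duality.\<close> On any nonempty subset of the cube, optimality of a finitely supported primal solution \<open>\<mu>\<close> forces every dual
  solution to be the gradient of \<open>f\<close> at \<open>A \<mu>\<close> (\<open>dual_solution_eq_gradient\<close>). A convex function
  with Lipschitz gradient exceeds its tangent by a multiple of the squared gradient difference, so
  if \<open>A_adj a (q k)\<close> violates the dual constraint of the full cube by at most \<open>\<epsilon>\<close>, then both the
  excess of the objective and \<open>norm (q k - qstar)^2\<close> are \<open>O(\<epsilon>)\<close> (\<open>duality_gap_bound\<close>).

  \<^emph>\<open>The violation is quadratic.\<close> The maximum of \<open>\<bar>A_adj a (q k)\<bar>\<close>, if it exceeds 1, is attained in
  the interior and lies in a candidate cell. The gradient vanishes there, and at the vertices of that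
  cell the modulus is at most 1; Taylor's formula gives \<open>\<epsilon> = O(e^2)\<close>
  (\<open>dual_violation_bound\<close>). Hence \<open>norm (q k - qstar) = O(e)\<close>, and the
  objective is optimal up to \<open>O(e^2)\<close>.

  \<^emph>\<open>Candidates sit near the peaks.\<close> Call the points where \<open>\<bar>A_adj a qstar\<bar> = 1\<close> peaks. Away from them
  the limiting certificate stays below 1 by compactness; near a peak it is strictly concave up to
  sign, and this is inherited by \<open>A_adj a (q k)\<close>. At the peak itself the value of the latter is at
  most \<open>1 + O(e^2)\<close> and its gradient is \<open>O(e)\<close>, so a point with value at least \<open>1 - \<kappa> e^2\<close> has
  distance \<open>O(e)\<close> from the peak (\<open>near_peak\<close>). Using the first-order information at the peak is
  essential: comparing values of the two certificates alone would only yield the distance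
  \<open>O(sqrt e)\<close>, and the number of candidates per level would be unbounded.

  \<^emph>\<open>Counting.\<close> By the previous step only a bounded multiple of \<open>S\<close> cells of each fine level can
  ever be refined, and no cell is refined twice. As every step before termination refines a cell of
  level at most \<open>J\<close>, the number of steps and the number of vertices grow linearly in \<open>J\<close>
  (\<open>card_refined_cells_le\<close>). There are only finitely many coarse cells, and how many does not depend
  on the run; they are absorbed into \<open>k0\<close>.
\<close>

section \<open>Finitely supported measures\<close>

text \<open>The measures that occur in the argument are finite sums of Dirac measures: iterates live on the
  finitely many vertices, and the limit is a Dirac comb by assumption. Indexing by the points
  themselves (rather than by numbers, as in \<open>dirac_comb\<close>) makes the weights unique.\<close>

definition comb :: "(real ^ 'd::finite) set \<Rightarrow> (real ^ 'd \<Rightarrow> real) \<Rightarrow> 'd smeasure" where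
  "comb F w = (\<lambda>E. if E \<in> sets borel then (\<Sum>v\<in>F. w v * indicator E v) else 0)"

lemma comb_borel: "E \<in> sets borel \<Longrightarrow> comb F w E = (\<Sum>v\<in>F. w v * indicator E v)"
  by (simp add: comb_def)

lemma comb_variation_le:
  assumes "finite F" "t \<in> variation_sums (comb F w)"
  shows "t \<le> (\<Sum>v\<in>F. \<bar>w v\<bar>)"
proof -
  obtain P where P: "finite P" "P \<subseteq> sets borel" "disjoint P" "t = (\<Sum>E\<in>P. \<bar>comb F w E\<bar>)"
    using assms(2) unfolding variation_sums_def by blast
  have one: "(\<Sum>E\<in>P. indicator E v) \<le> (1::real)" for v
  proof (cases "v \<in> \<Union>P")
    case True
    then obtain E where E: "E \<in> P" "v \<in> E" by blast
    have "(\<Sum>E'\<in>P. indicator E' v) = (\<Sum>E'\<in>P. if E' = E then 1 else (0::real))"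
      using P(3) E by (intro sum.cong) (auto simp: indicator_def disjoint_def)
    then show ?thesis using P(1) E by simp
  next
    case False
    then have "(\<Sum>E'\<in>P. indicator E' v) = (\<Sum>E'\<in>P. (0::real))"
      by (intro sum.cong) (auto simp: indicator_def)
    then show ?thesis by simp
  qed
  have "t \<le> (\<Sum>E\<in>P. \<Sum>v\<in>F. \<bar>w v\<bar> * indicator E v)"
    unfolding P(4)
  proof (rule sum_mono)
    fix E assume "E \<in> P"
    then have "comb F w E = (\<Sum>v\<in>F. w v * indicator E v)" using P(2) comb_borel by blast
    also have "\<bar>\<dots>\<bar> \<le> (\<Sum>v\<in>F. \<bar>w v * indicator E v\<bar>)" by (rule sum_abs)
    finally show "\<bar>comb F w E\<bar> \<le> (\<Sum>v\<in>F. \<bar>w v\<bar> * indicator E v)" by (simp add: abs_mult)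
  qed
  also have "\<dots> = (\<Sum>v\<in>F. \<bar>w v\<bar> * (\<Sum>E\<in>P. indicator E v))"
    by (subst sum.swap) (simp add: sum_distrib_left)
  also have "\<dots> \<le> (\<Sum>v\<in>F. \<bar>w v\<bar> * 1)"
    by (intro sum_mono mult_left_mono one) auto
  finally show ?thesis by simp
qed

lemma tv_norm_comb:
  assumes "finite F"
  shows "tv_norm (comb F w) = (\<Sum>v\<in>F. \<bar>w v\<bar>)"
proof -
  have "(\<Sum>v\<in>F. \<bar>w v\<bar>) \<in> variation_sums (comb F w)"
  proof -
    have "\<bar>comb F w {v}\<bar> = \<bar>w v\<bar>" if "v \<in> F" for v
    proof -
      have "comb F w {v} = (\<Sum>u\<in>F. if u = v then w v else 0)"
        unfolding comb_borel[OF borel_closed[OF closed_singleton]]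
        by (intro sum.cong) (auto simp: indicator_def)
      then show ?thesis using assms that by simp
    qed
    then have "(\<Sum>E\<in>(\<lambda>v. {v}) ` F. \<bar>comb F w E\<bar>) = (\<Sum>v\<in>F. \<bar>w v\<bar>)"
      by (subst sum.reindex) auto
    moreover have "disjoint ((\<lambda>v. {v}) ` F)" by (auto simp: disjoint_def)
    moreover have "(\<lambda>v. {v}) ` F \<subseteq> sets borel" by auto
    moreover have "finite ((\<lambda>v. {v}) ` F)" using assms by simp
    ultimately show ?thesis
      unfolding variation_sums_def by (metis (mono_tags, lifting) mem_Collect_eq)
  qed
  then show ?thesis
    unfolding tv_norm_def using comb_variation_le[OF assms] by (rule cSup_eq_maximum)
qed

lemma comb_measures_on:
  assumes "finite F" "F \<subseteq> V"
  shows "comb F w \<in> measures_on V"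
proof -
  have add: "(\<lambda>n. comb F w (G n)) sums comb F w (\<Union>n. G n)"
    if G: "range G \<subseteq> sets borel" "disjoint_family G" for G :: "nat \<Rightarrow> _"
  proof -
    have U: "(\<Union>n. G n) \<in> sets borel" using G(1) by auto
    have "(\<lambda>n. indicator (G n) v) sums (indicator (\<Union>n. G n) v :: real)" for v
    proof (cases "v \<in> (\<Union>n. G n)")
      case True
      then obtain n where n: "v \<in> G n" by blast
      have "(indicator (G i) v :: real) = 0" if "i \<noteq> n" for i
        using G(2) n that by (auto simp: disjoint_family_on_def indicator_def)
      then have "(\<lambda>i. indicator (G i) v) sums (\<Sum>i\<in>{n}. indicator (G i) v :: real)"
        by (intro sums_finite) auto
      moreover have "(\<Sum>i\<in>{n}. indicator (G i) v :: real) = 1" using n by simp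
      moreover have "(indicator (\<Union>n. G n) v :: real) = 1"
        by (rule indicator_simps(1)[OF True])
      ultimately show ?thesis by metis
    next
      case False
      then have "(\<lambda>n. indicator (G n) v) = (\<lambda>n. 0 :: real)"
        by (auto simp: indicator_def fun_eq_iff)
      moreover have "(indicator (\<Union>n. G n) v :: real) = 0"
        by (rule indicator_simps(2)[OF False])
      ultimately show ?thesis by simp
    qed
    then have "(\<lambda>n. \<Sum>v\<in>F. w v * indicator (G n) v) sums (\<Sum>v\<in>F. w v * indicator (\<Union>n. G n) v)"
      by (intro sums_sum sums_mult)
    moreover have "(\<lambda>n. comb F w (G n)) = (\<lambda>n. \<Sum>v\<in>F. w v * indicator (G n) v)"
      using G(1) by (auto simp: fun_eq_iff intro!: comb_borel)
    ultimately show ?thesis using comb_borel[OF U] by metis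
  qed
  have "bdd_above (variation_sums (comb F w))"
    using comb_variation_le[OF assms(1)] by (meson bdd_above.I)
  moreover have "comb F w E = 0" if "E \<inter> V = {}" for E
    using that assms(2) by (auto simp: comb_def indicator_def intro!: sum.neutral)
  moreover have "comb F w {} = 0" "E \<notin> sets borel \<Longrightarrow> comb F w E = 0" for E
    by (simp_all add: comb_def)
  ultimately show ?thesis
    unfolding measures_on_def signed_measure_def using add by blast
qed

text \<open>Finite additivity already determines a measure that is supported on finitely many points.\<close>

lemma measures_on_finite_eq_comb:
  assumes mu: "\<mu> \<in> measures_on V" and fin: "finite V"
  shows "\<mu> = comb V (\<lambda>v. \<mu> {v})"
proof
  fix E
  have sm: "signed_measure \<mu>" and supp: "\<And>E. E \<in> sets borel \<Longrightarrow> E \<inter> V = {} \<Longrightarrow> \<mu> E = 0"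
    using mu by (auto simp: measures_on_def)
  have e: "\<mu> {} = 0" using sm by (simp add: signed_measure_def)
  have add: "\<mu> (A \<union> B) = \<mu> A + \<mu> B"
    if AB: "A \<in> sets borel" "B \<in> sets borel" "A \<inter> B = {}" for A B
  proof -
    have r: "range (binaryset A B) \<subseteq> sets borel" using AB by (auto simp: range_binaryset_eq)
    have d: "disjoint_family (binaryset A B)"
      using AB(3) by (auto simp: disjoint_family_on_def binaryset_def)
    have "\<forall>F :: nat \<Rightarrow> _. range F \<subseteq> sets borel \<longrightarrow> disjoint_family F \<longrightarrow>
        (\<lambda>n. \<mu> (F n)) sums \<mu> (\<Union>n. F n)" using sm unfolding signed_measure_def by blast
    then have "(\<lambda>n. \<mu> (binaryset A B n)) sums \<mu> (\<Union>n. binaryset A B n)" using r d by blast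
    moreover have "(\<lambda>n. \<mu> (binaryset A B n)) sums (\<mu> A + \<mu> B)" by (rule binaryset_sums) (rule e)
    ultimately show ?thesis by (metis UN_binaryset_eq sums_unique2)
  qed
  have fs: "\<mu> W = (\<Sum>v\<in>W. \<mu> {v})" if "finite W" for W
    using that
  proof induction
    case (insert v W)
    then have "\<mu> ({v} \<union> W) = \<mu> {v} + \<mu> W"
      by (intro add) (auto intro: borel_closed finite_imp_closed)
    then show ?case using insert by simp
  qed (simp add: e)
  show "\<mu> E = comb V (\<lambda>v. \<mu> {v}) E"
  proof (cases "E \<in> sets borel")
    case True
    have VB: "V \<in> sets borel" using fin by (intro borel_closed finite_imp_closed)
    have "\<mu> ((E \<inter> V) \<union> (E - V)) = \<mu> (E \<inter> V) + \<mu> (E - V)"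
      using True VB by (intro add) auto
    moreover have "\<mu> (E - V) = 0" using True VB by (intro supp) auto
    moreover have "(E \<inter> V) \<union> (E - V) = E" by blast
    ultimately have "\<mu> E = (\<Sum>v\<in>E \<inter> V. \<mu> {v})" using fs[of "E \<inter> V"] fin by simp
    also have "\<dots> = (\<Sum>v\<in>V. \<mu> {v} * indicator E v)"
      using fin by (auto simp: indicator_def sum.If_cases Int_commute if_distrib cong: if_cong)
    finally show ?thesis using True by (simp add: comb_def)
  next
    case False
    then show ?thesis using sm by (simp add: signed_measure_def comb_def)
  qed
qed

text \<open>The supremum over subsets of \<open>E\<close> is attained at the points of \<open>E\<close> with positive weight, so the upper
  variation is the point measure of the positive parts; \<open>ennreal\<close> already truncates the negative weights.\<close>

lemma upper_variation_comb:
  assumes fin: "finite F"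
  shows "upper_variation (comb F w) = distr (point_measure F (\<lambda>v. ennreal (w v))) borel (\<lambda>v. v)"
    (is "_ = ?N")
proof -
  have meas: "(\<lambda>v. v) \<in> measurable (point_measure F (\<lambda>v. ennreal (w v))) borel"
    by (simp add: measurable_def)
  have eN: "emeasure ?N E = (\<Sum>v\<in>F \<inter> E. ennreal (w v))" if "E \<in> sets borel" for E
  proof -
    have "emeasure ?N E = emeasure (point_measure F (\<lambda>v. ennreal (w v))) (F \<inter> E)"
      using that meas by (simp add: emeasure_distr space_point_measure Int_commute)
    also have "\<dots> = (\<Sum>v\<in>F \<inter> E. ennreal (w v))"
      by (rule emeasure_point_measure_finite) (use fin in auto)
    finally show ?thesis .
  qed
  have pos: "ennreal (\<Sum>v\<in>G. max 0 (w v)) = (\<Sum>v\<in>G. ennreal (w v))" for G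
  proof -
    have "ennreal (max 0 t) = ennreal t" for t by (auto simp: max_def ennreal_neg)
    moreover have "(\<Sum>v\<in>G. ennreal (max 0 (w v))) = ennreal (\<Sum>v\<in>G. max 0 (w v))"
      by (rule sum_ennreal) simp
    ultimately show ?thesis by simp
  qed
  have "(SUP B\<in>{B \<in> sets borel. B \<subseteq> E}. ennreal (comb F w B)) = emeasure ?N E"
    if E: "E \<in> sets borel" for E
  proof (rule antisym)
    show "(SUP B\<in>{B \<in> sets borel. B \<subseteq> E}. ennreal (comb F w B)) \<le> emeasure ?N E"
    proof (rule SUP_least)
      fix B assume "B \<in> {B \<in> sets borel. B \<subseteq> E}"
      then have B: "B \<in> sets borel" "B \<subseteq> E" by auto
      have "comb F w B = (\<Sum>v\<in>F. w v * indicator B v)" by (rule comb_borel[OF B(1)])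
      also have "\<dots> \<le> (\<Sum>v\<in>F. max 0 (w v) * indicator E v)"
        using B(2) by (intro sum_mono) (auto simp: indicator_def)
      also have "\<dots> = (\<Sum>v\<in>F \<inter> E. max 0 (w v))"
        using fin by (auto simp: indicator_def sum.If_cases if_distrib cong: if_cong)
      finally have "ennreal (comb F w B) \<le> ennreal (\<Sum>v\<in>F \<inter> E. max 0 (w v))"
        by (rule ennreal_leI)
      also have "\<dots> = (\<Sum>v\<in>F \<inter> E. ennreal (w v))"
        by (rule pos)
      finally show "ennreal (comb F w B) \<le> emeasure ?N E" using eN[OF E] by simp
    qed
    define B where "B = {v\<in>F \<inter> E. 0 \<le> w v}"
    have fB: "finite B" using fin by (simp add: B_def)
    have Bb: "B \<in> sets borel" using fB by (intro borel_closed finite_imp_closed)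
    have "comb F w B = (\<Sum>v\<in>F. w v * indicator B v)" by (rule comb_borel[OF Bb])
    also have "\<dots> = (\<Sum>v\<in>F. max 0 (w v) * indicator E v)"
      by (intro sum.cong) (auto simp: indicator_def B_def)
    also have "\<dots> = (\<Sum>v\<in>F \<inter> E. max 0 (w v))"
      using fin by (auto simp: indicator_def sum.If_cases if_distrib cong: if_cong)
    finally have "ennreal (comb F w B) = ennreal (\<Sum>v\<in>F \<inter> E. max 0 (w v))" by simp
    also have "\<dots> = (\<Sum>v\<in>F \<inter> E. ennreal (w v))"
      by (rule pos)
    also have "\<dots> = emeasure ?N E" using eN[OF E] by simp
    finally have "emeasure ?N E = ennreal (comb F w B)" by simp
    also have "\<dots> \<le> (SUP B\<in>{B \<in> sets borel. B \<subseteq> E}. ennreal (comb F w B))"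
      by (rule SUP_upper) (use Bb in \<open>auto simp: B_def\<close>)
    finally show "emeasure ?N E \<le> (SUP B\<in>{B \<in> sets borel. B \<subseteq> E}. ennreal (comb F w B))" .
  qed
  then have "upper_variation (comb F w) = measure_of UNIV (sets borel) (emeasure ?N)"
    unfolding upper_variation_def
    by (intro measure_of_eq) (auto simp: borel_def sigma_sets_sigma_sets_eq)
  also have "\<dots> = ?N"
    using measure_of_of_measure[of ?N] by simp
  finally show ?thesis .
qed

lemma signed_integral_comb:
  assumes fin: "finite F" and sub: "F \<subseteq> X" and X: "X \<in> sets borel" and g: "continuous_on X g"
  shows "signed_integral X g (comb F w) = (\<Sum>v\<in>F. w v * g v)"
proof -
  have int: "(LINT x:X|upper_variation (comb F u). g x) = (\<Sum>v\<in>F. max 0 (u v) * g v)" for u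
  proof -
    have m: "(\<lambda>v. v) \<in> measurable (point_measure F (\<lambda>v. ennreal (u v))) borel"
      by (simp add: measurable_def)
    have eq: "point_measure F (\<lambda>v. ennreal (u v)) = point_measure F (\<lambda>v. ennreal (max 0 (u v)))"
      by (auto simp: max_def ennreal_neg intro!: arg_cong[where f="point_measure F"] ext)
    have "(LINT x:X|upper_variation (comb F u). g x) =
        (LINT x|point_measure F (\<lambda>v. ennreal (u v)). indicator X x *\<^sub>R g x)"
      unfolding set_lebesgue_integral_def upper_variation_comb[OF fin]
      by (rule integral_distr[OF m borel_measurable_continuous_on_indicator[OF X g]])
    also have "\<dots> = (\<Sum>v\<in>F. max 0 (u v) *\<^sub>R (indicator X v *\<^sub>R g v))"
      unfolding eq by (rule lebesgue_integral_point_measure_finite[OF fin]) auto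
    also have "\<dots> = (\<Sum>v\<in>F. max 0 (u v) * g v)"
      using sub by (intro sum.cong) (auto simp: indicator_def)
    finally show ?thesis .
  qed
  have neg: "(\<lambda>E. - comb F w E) = comb F (\<lambda>v. - w v)"
    by (auto simp: comb_def fun_eq_iff sum_negf)
  show ?thesis
    unfolding signed_integral_def lower_variation_def neg int sum_subtractf[symmetric]
    by (intro sum.cong) (auto simp: max_def)
qed

section \<open>Convex functions with Lipschitz gradient\<close>

text \<open>The common core of all first-order optimality conditions below.\<close>

lemma DERIV_ge_if_above_line:
  fixes \<phi> :: "real \<Rightarrow> real"
  assumes der: "DERIV \<phi> 0 :> D" and above: "\<And>t. 0 < t \<Longrightarrow> t < 1 \<Longrightarrow> \<phi> 0 + t * c \<le> \<phi> t"
  shows "c \<le> D"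
proof (rule tendsto_lowerbound)
  show "((\<lambda>t. (\<phi> t - \<phi> 0) / t) \<longlongrightarrow> D) (at_right 0)"
    using der unfolding has_field_derivative_iff by (simp add: filterlim_at_split)
  show "\<forall>\<^sub>F t in at_right 0. c \<le> (\<phi> t - \<phi> 0) / t"
    unfolding eventually_at_right_field
    by (rule exI[of _ 1]) (use above in \<open>auto simp: field_simps\<close>)
qed simp

lemma DERIV_along_line:
  fixes f :: "'a::real_inner \<Rightarrow> real"
  assumes "GDERIV f (x + t *\<^sub>R h) :> g"
  shows "DERIV (\<lambda>t. f (x + t *\<^sub>R h)) t :> h \<bullet> g"
proof -
  have "((\<lambda>t. x + t *\<^sub>R h) has_derivative (\<lambda>s. s *\<^sub>R h)) (at t)"
    by (auto intro!: derivative_eq_intros)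
  then have "((\<lambda>t. f (x + t *\<^sub>R h)) has_derivative (\<lambda>s. (s *\<^sub>R h) \<bullet> g)) (at t)"
    using assms unfolding gderiv_def by (rule has_derivative_compose)
  then show ?thesis by (simp add: has_field_derivative_def mult.commute[of _ "h \<bullet> g"])
qed

lemma convex_above_tangent:
  fixes f :: "'a::real_inner \<Rightarrow> real"
  assumes conv: "convex_on UNIV f" and grad: "GDERIV f x :> g"
  shows "f x + (y - x) \<bullet> g \<le> f y"
proof -
  have "DERIV (\<lambda>t. f (x + t *\<^sub>R (y - x))) 0 :> (y - x) \<bullet> g"
    by (rule DERIV_along_line) (use grad in simp)
  then have "DERIV (\<lambda>t. - f (x + t *\<^sub>R (y - x))) 0 :> - ((y - x) \<bullet> g)"
    by (rule DERIV_minus)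
  then have "f x - f y \<le> - ((y - x) \<bullet> g)"
  proof (rule DERIV_ge_if_above_line)
    fix t :: real assume t: "0 < t" "t < 1"
    have "x + t *\<^sub>R (y - x) = (1 - t) *\<^sub>R x + t *\<^sub>R y" by (simp add: algebra_simps)
    then have "f (x + t *\<^sub>R (y - x)) \<le> (1 - t) * f x + t * f y"
      using conv t convex_onD[of UNIV f t x y] by simp
    then show "- f (x + 0 *\<^sub>R (y - x)) + t * (f x - f y) \<le> - f (x + t *\<^sub>R (y - x))"
      by (simp add: algebra_simps)
  qed
  then show ?thesis by simp
qed

lemma lipschitz_gradient_upper_bound:
  fixes f :: "'a::real_inner \<Rightarrow> real"
  assumes grad: "\<And>y. GDERIV f y :> gradf y" and lip: "L-lipschitz_on UNIV gradf"
  shows "f (x + h) \<le> f x + h \<bullet> gradf x + L * (norm h)\<^sup>2 / 2"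
proof -
  define \<psi> where "\<psi> t = f (x + t *\<^sub>R h) - t * (h \<bullet> gradf x) - L * (norm h)\<^sup>2 * t\<^sup>2 / 2" for t
  have "\<psi> 1 \<le> \<psi> 0"
  proof (rule DERIV_nonpos_imp_nonincreasing[where f = \<psi>])
    fix t :: real assume t: "0 \<le> t" "t \<le> 1"
    let ?D = "h \<bullet> gradf (x + t *\<^sub>R h) - h \<bullet> gradf x - L * (norm h)\<^sup>2 * t"
    have "DERIV \<psi> t :> ?D"
      unfolding \<psi>_def
      by (auto intro!: derivative_eq_intros DERIV_along_line grad simp: power2_eq_square)
    moreover have "?D \<le> 0"
    proof -
      have "h \<bullet> gradf (x + t *\<^sub>R h) - h \<bullet> gradf x = h \<bullet> (gradf (x + t *\<^sub>R h) - gradf x)"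
        by (simp add: inner_diff_right)
      also have "\<dots> \<le> norm h * norm (gradf (x + t *\<^sub>R h) - gradf x)" by (rule norm_cauchy_schwarz)
      also have "\<dots> \<le> norm h * (L * (t * norm h))"
        using lipschitz_onD[OF lip, of "x + t *\<^sub>R h" x] t
        by (intro mult_left_mono) (auto simp: dist_norm)
      finally show ?thesis by (simp add: power2_eq_square mult_ac)
    qed
    ultimately show "\<exists>y. DERIV \<psi> t :> y \<and> y \<le> 0" by blast
  qed simp
  then show ?thesis by (simp add: \<psi>_def)
qed

text \<open>Convexity sharpened by smoothness (co-coercivity of the gradient). The tangent at \<open>x\<close> bounds \<open>f\<close>
  from below at the point reached from \<open>y\<close> by adding \<open>- 1 / L\<close> times the gradient difference, and
  the quadratic upper bound at \<open>y\<close> bounds \<open>f\<close> there from above; the claim compares the two bounds.\<close>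

lemma convex_lipschitz_gradient_lower_bound:
  fixes f :: "'a::real_inner \<Rightarrow> real"
  assumes conv: "convex_on UNIV f" and grad: "\<And>y. GDERIV f y :> gradf y"
    and lip: "L-lipschitz_on UNIV gradf" and L: "L > 0"
  shows "f x + (y - x) \<bullet> gradf x + (norm (gradf y - gradf x))\<^sup>2 / (2 * L) \<le> f y"
proof -
  define d where "d = gradf y - gradf x"
  \<comment> \<open>the minimizer of the quadratic upper bound at \<open>y\<close> minus the tangent at \<open>x\<close>\<close>
  define h where "h = - (1 / L) *\<^sub>R d"
  have "f x + (y + h - x) \<bullet> gradf x \<le> f (y + h)" by (rule convex_above_tangent[OF conv grad])
  also have "\<dots> \<le> f y + h \<bullet> gradf y + L * (norm h)\<^sup>2 / 2"
    by (rule lipschitz_gradient_upper_bound[OF grad lip])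
  finally have "f x + (y - x) \<bullet> gradf x \<le> f y + h \<bullet> d + L * (norm h)\<^sup>2 / 2"
    by (simp add: d_def inner_diff_right inner_add_left inner_diff_left)
  moreover have "h \<bullet> d = - (norm d)\<^sup>2 / L" by (simp add: h_def power2_norm_eq_inner)
  moreover have "L * (norm h)\<^sup>2 / 2 = (norm d)\<^sup>2 / (2 * L)"
    using L by (simp add: h_def power_mult_distrib power2_eq_square)
  ultimately show ?thesis using L by (simp add: d_def field_simps)
qed

section \<open>Duality\<close>

lemma A_adj_inner: "A_adj a q x = q \<bullet> (\<chi> m. a m x)"
  by (simp add: A_adj_def inner_vec_def)

lemma compact_Cube: "compact Cube"
  by (simp add: Cube_def compact_cbox)

lemma continuous_on_A_adj:
  assumes "\<And>m. continuous_on X (a m)"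
  shows "continuous_on X (A_adj a q)"
  unfolding A_adj_def by (intro continuous_intros assms)

lemma A_op_comb:
  assumes "\<And>m. continuous_on Cube (a m)" "finite F" "F \<subseteq> Cube"
  shows "A_op a (comb F w) = (\<Sum>v\<in>F. w v *\<^sub>R (\<chi> m. a m v))"
proof -
  have "signed_integral Cube (a m) (comb F w) = (\<Sum>v\<in>F. w v * a m v)" for m
    by (rule signed_integral_comb) (use assms in \<open>auto intro: borel_closed simp: Cube_def\<close>)
  then show ?thesis by (simp add: A_op_def vec_eq_iff)
qed

lemma inner_A_op_comb_ge:
  assumes a: "\<And>m. continuous_on Cube (a m)" and F: "finite F" "F \<subseteq> Cube"
    and le: "\<And>v. v \<in> F \<Longrightarrow> \<bar>A_adj a q v\<bar> \<le> c"
  shows "- c * tv_norm (comb F w) \<le> q \<bullet> A_op a (comb F w)"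
proof -
  have "- c * tv_norm (comb F w) = (\<Sum>v\<in>F. - (\<bar>w v\<bar> * c))"
    by (simp add: tv_norm_comb[OF F(1)] sum_negf sum_distrib_left mult.commute)
  also have "\<dots> \<le> (\<Sum>v\<in>F. w v * A_adj a q v)"
  proof (rule sum_mono)
    fix v assume "v \<in> F"
    then have "\<bar>w v * A_adj a q v\<bar> \<le> \<bar>w v\<bar> * c"
      unfolding abs_mult by (intro mult_left_mono le) auto
    then show "- (\<bar>w v\<bar> * c) \<le> w v * A_adj a q v" by linarith
  qed
  also have "\<dots> = q \<bullet> A_op a (comb F w)"
    by (simp add: A_op_comb[OF a F] inner_sum_right A_adj_inner)
  finally show ?thesis .
qed

text \<open>Both conditions come from one-sided directional derivatives: the first from adding a small multiple
  of a Dirac measure at \<open>x\<close>, which costs at most its mass in total variation; the second from scaling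
  the solution up and down.\<close>

lemma primal_optimality:
  assumes a: "\<And>m. continuous_on Cube (a m)" and grad: "\<And>y. GDERIV f y :> gradf y"
    and F: "finite F" "F \<subseteq> V" and V: "V \<subseteq> Cube"
    and opt: "primal_solution a f V (comb F w)"
  shows "\<And>x. x \<in> V \<Longrightarrow> \<bar>A_adj a (gradf (A_op a (comb F w))) x\<bar> \<le> 1"
    and "gradf (A_op a (comb F w)) \<bullet> A_op a (comb F w) = - tv_norm (comb F w)"
proof -
  define y where "y = A_op a (comb F w)"
  define T where "T = tv_norm (comb F w)"
  have FC: "F \<subseteq> Cube" using F V by blast
  \<comment> \<open>competitors enter only through their weights and the vectors \<open>(a m v)\<close>\<close>
  have min: "T + f y \<le> (\<Sum>v\<in>G. \<bar>u v\<bar>) + f (\<Sum>v\<in>G. u v *\<^sub>R (\<chi> m. a m v))"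
    if G: "finite G" "G \<subseteq> V" for G u
  proof -
    have "objective a f (comb F w) \<le> objective a f (comb G u)"
      using opt comb_measures_on[OF G] unfolding primal_solution_def by blast
    moreover have "G \<subseteq> Cube" using G V by blast
    ultimately show ?thesis
      by (simp add: objective_def T_def y_def tv_norm_comb[OF G(1)] A_op_comb[OF a G(1)])
  qed
  have y: "y = (\<Sum>v\<in>F. w v *\<^sub>R (\<chi> m. a m v))"
    unfolding y_def by (rule A_op_comb[OF a F(1) FC])
  have T: "T = (\<Sum>v\<in>F. \<bar>w v\<bar>)" unfolding T_def by (rule tv_norm_comb[OF F(1)])
  have slope: "c \<le> h \<bullet> gradf y" if "\<And>t. 0 < t \<Longrightarrow> t < 1 \<Longrightarrow> f y + t * c \<le> f (y + t *\<^sub>R h)" for c h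
    by (rule DERIV_ge_if_above_line[of "\<lambda>t. f (y + t *\<^sub>R h)"], rule DERIV_along_line)
      (use that grad in auto)
  show "\<bar>A_adj a (gradf (A_op a (comb F w))) x\<bar> \<le> 1" if x: "x \<in> V" for x
  proof -
    let ?G = "insert x F"
    have one: "- 1 \<le> (\<sigma> *\<^sub>R (\<chi> m. a m x)) \<bullet> gradf y" if \<sigma>: "\<bar>\<sigma>\<bar> = 1" for \<sigma> :: real
    proof (rule slope)
      fix t :: real assume t: "0 < t" "t < 1"
      define w0 where "w0 v = (if v \<in> F then w v else 0)" for v
      \<comment> \<open>\<open>x\<close> may already carry mass, so the weights are first extended by 0 to \<open>insert x F\<close>\<close>
      define u where "u v = w0 v + (if v = x then t * \<sigma> else 0)" for v
      have G: "finite ?G" "?G \<subseteq> V" using F x by auto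
      have s0: "(\<Sum>v\<in>?G. \<bar>w0 v\<bar>) = T"
        unfolding T by (rule sum.mono_neutral_cong_right) (use F in \<open>auto simp: w0_def\<close>)
      have s1: "(\<Sum>v\<in>?G. w0 v *\<^sub>R (\<chi> m. a m v)) = y"
        unfolding y by (rule sum.mono_neutral_cong_right) (use F in \<open>auto simp: w0_def\<close>)
      have "(\<Sum>v\<in>?G. \<bar>u v\<bar>) \<le> (\<Sum>v\<in>?G. \<bar>w0 v\<bar> + (if v = x then t else 0))"
        using t \<sigma> by (intro sum_mono) (auto simp: u_def abs_mult intro: order_trans[OF abs_triangle_ineq])
      also have "\<dots> = T + t" using G(1) by (simp add: sum.distrib s0)
      finally have a1: "(\<Sum>v\<in>?G. \<bar>u v\<bar>) \<le> T + t" .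
      have "(\<Sum>v\<in>?G. u v *\<^sub>R (\<chi> m. a m v)) =
          (\<Sum>v\<in>?G. w0 v *\<^sub>R (\<chi> m. a m v) + (if v = x then (t * \<sigma>) *\<^sub>R (\<chi> m. a m x) else 0))"
        by (intro sum.cong) (auto simp: u_def scaleR_add_left)
      also have "\<dots> = y + (t * \<sigma>) *\<^sub>R (\<chi> m. a m x)"
        unfolding sum.distrib s1 using G(1) by simp
      finally show "f y + t * (- 1) \<le> f (y + t *\<^sub>R (\<sigma> *\<^sub>R (\<chi> m. a m x)))"
        using min[OF G, of u] a1 by simp
    qed
    show ?thesis
      using one[of 1] one[of "- 1"] by (simp add: A_adj_inner y_def[symmetric] inner_commute abs_le_iff)
  qed
  have two: "- \<sigma> * T \<le> (\<sigma> *\<^sub>R y) \<bullet> gradf y" if \<sigma>: "\<bar>\<sigma>\<bar> = 1" for \<sigma> :: real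
  proof (rule slope)
    fix t :: real assume t: "0 < t" "t < 1"
    have "\<bar>t * \<sigma>\<bar> \<le> 1" using t \<sigma> by (simp add: abs_mult)
    then have pos: "0 \<le> 1 + t * \<sigma>" by linarith
    have "(\<Sum>v\<in>F. \<bar>(1 + t * \<sigma>) * w v\<bar>) = (1 + t * \<sigma>) * T"
      using pos by (simp add: T abs_mult sum_distrib_left)
    moreover have "(\<Sum>v\<in>F. ((1 + t * \<sigma>) * w v) *\<^sub>R (\<chi> m. a m v)) = (1 + t * \<sigma>) *\<^sub>R y"
      by (simp add: y scaleR_sum_right)
    ultimately show "f y + t * (- \<sigma> * T) \<le> f (y + t *\<^sub>R (\<sigma> *\<^sub>R y))"
      using min[OF F, of "\<lambda>v. (1 + t * \<sigma>) * w v"] by (simp add: algebra_simps)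
  qed
  show "gradf (A_op a (comb F w)) \<bullet> A_op a (comb F w) = - tv_norm (comb F w)"
    using two[of 1] two[of "- 1"] by (simp add: y_def[symmetric] T_def[symmetric] inner_commute)
qed

text \<open>Let \<open>y = A \<mu>\<close> and let \<open>T\<close> be the total variation of the primal solution \<open>\<mu>\<close>. The gradient at \<open>y\<close> is
  dual feasible and its conjugate is at most \<open>- T - f y\<close>, hence so is the conjugate at any dual
  solution \<open>q\<close>. Together with feasibility of \<open>q\<close> this is the equality case
  of the Fenchel--Young inequality, that is, \<open>q\<close> is a subgradient of the differentiable function \<open>f\<close> at \<open>y\<close>.
  In particular dual solutions are unique.\<close>

lemma dual_solution_eq_gradient:
  assumes a: "\<And>m. continuous_on Cube (a m)" and conv: "convex_on UNIV f"
    and grad: "\<And>y. GDERIV f y :> gradf y"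
    and F: "finite F" "F \<subseteq> V" and V: "V \<subseteq> Cube" "V \<noteq> {}"
    and primal: "primal_solution a f V (comb F w)" and dual: "dual_solution a f V q"
  shows "q = gradf (A_op a (comb F w))"
    and "q \<bullet> A_op a (comb F w) = - tv_norm (comb F w)"
    and "\<And>x. x \<in> V \<Longrightarrow> \<bar>A_adj a q x\<bar> \<le> 1"
proof -
  define y where "y = A_op a (comb F w)"
  define T where "T = tv_norm (comb F w)"
  define p where "p = gradf y"
  note opt = primal_optimality[OF a grad F V(1) primal, folded y_def T_def, folded p_def]
  have bdd: "bdd_above ((\<lambda>x. \<bar>A_adj a q x\<bar>) ` V)"
  proof (rule bdd_above_mono)
    have "compact ((\<lambda>x. \<bar>A_adj a q x\<bar>) ` Cube)"
      by (intro compact_continuous_image compact_Cube continuous_intros continuous_on_A_adj a)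
    then show "bdd_above ((\<lambda>x. \<bar>A_adj a q x\<bar>) ` Cube)"
      by (intro bounded_imp_bdd_above compact_imp_bounded)
  qed (use V in blast)
  show feas: "\<bar>A_adj a q x\<bar> \<le> 1" if "x \<in> V" for x
    using cSUP_upper[OF that bdd] dual unfolding dual_solution_def sup_norm_def by linarith
  have "sup_norm V (A_adj a p) \<le> 1"
    unfolding sup_norm_def using V(2) opt(1) by (intro cSUP_least) auto
  then have "- fenchel_conjugate f p \<le> - fenchel_conjugate f q"
    using dual unfolding dual_solution_def by blast
  then have "fenchel_conjugate f q \<le> fenchel_conjugate f p" by simp
  also have "\<dots> \<le> ereal (- T - f y)"
    unfolding fenchel_conjugate_def
  proof (rule SUP_least)
    fix z
    have "f y + (z - y) \<bullet> p \<le> f z" unfolding p_def by (rule convex_above_tangent[OF conv grad])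
    then show "ereal (p \<bullet> z - f z) \<le> ereal (- T - f y)"
      using opt(2) by (simp add: inner_diff_left inner_diff_right inner_commute)
  qed
  finally have conj: "q \<bullet> z - f z \<le> - T - f y" for z
    unfolding fenchel_conjugate_def SUP_le_iff by simp
  have "F \<subseteq> Cube" using F V by blast
  then have "- 1 * T \<le> q \<bullet> y"
    unfolding T_def y_def by (rule inner_A_op_comb_ge[OF a F(1)]) (use F feas in blast)
  then have qy: "q \<bullet> y = - T" using conj[of y] by simp
  then show "q \<bullet> A_op a (comb F w) = - tv_norm (comb F w)" by (simp add: y_def T_def)
  have "(q - p) \<bullet> q \<le> (q - p) \<bullet> p"
  proof (rule DERIV_ge_if_above_line[of "\<lambda>t. f (y + t *\<^sub>R (q - p))"])
    show "DERIV (\<lambda>t. f (y + t *\<^sub>R (q - p))) 0 :> (q - p) \<bullet> p"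
      by (rule DERIV_along_line) (use grad in \<open>simp add: p_def\<close>)
    fix t :: real
    show "f (y + 0 *\<^sub>R (q - p)) + t * ((q - p) \<bullet> q) \<le> f (y + t *\<^sub>R (q - p))"
      using conj[of "y + t *\<^sub>R (q - p)"] qy
      by (simp add: inner_add_right inner_commute[of q "q - p"])
  qed
  then have "(q - p) \<bullet> (q - p) \<le> 0" by (simp add: inner_diff_right)
  then have "q = p" by (metis inner_gt_zero_iff not_le right_minus_eq)
  then show "q = gradf (A_op a (comb F w))"
    by (simp add: p_def y_def)
qed

text \<open>The sharpened tangent inequality for \<open>f\<close> at \<open>A \<mu>\<close>, evaluated at the comparison measure. The pairing
  of \<open>q\<close> with the comparison measure is at least \<open>- (1 + \<epsilon>)\<close> times the total variation of the latter,
  whereas its pairing with \<open>\<mu>\<close> cancels the total variation of \<open>\<mu>\<close> exactly.\<close>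

lemma duality_gap_bound:
  assumes a: "\<And>m. continuous_on Cube (a m)" and conv: "convex_on UNIV f"
    and grad: "\<And>y. GDERIV f y :> gradf y" and lip: "L-lipschitz_on UNIV gradf" and L: "L > 0"
    and F: "finite F" "F \<subseteq> Cube"
    and star: "q0 = gradf (A_op a (comb F w))"
    and q: "q = gradf (A_op a \<mu>)" "q \<bullet> A_op a \<mu> = - tv_norm \<mu>"
    and eps: "\<And>x. x \<in> Cube \<Longrightarrow> \<bar>A_adj a q x\<bar> \<le> 1 + \<epsilon>"
  shows "objective a f \<mu> - objective a f (comb F w) + (norm (q - q0))\<^sup>2 / (2 * L)
    \<le> \<epsilon> * tv_norm (comb F w)"
proof -
  have "- (1 + \<epsilon>) * tv_norm (comb F w) \<le> q \<bullet> A_op a (comb F w)"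
    by (rule inner_A_op_comb_ge[OF a F]) (use eps F in blast)
  moreover have "f (A_op a \<mu>) + (A_op a (comb F w) - A_op a \<mu>) \<bullet> q + (norm (q0 - q))\<^sup>2 / (2 * L)
      \<le> f (A_op a (comb F w))"
    unfolding star q(1) by (rule convex_lipschitz_gradient_lower_bound[OF conv grad lip L])
  ultimately show ?thesis
    using q(2) by (simp add: objective_def inner_diff_left inner_commute norm_minus_commute algebra_simps)
qed

text \<open>Coercivity bounds the mass of every solution uniformly in the set on which the problem is posed,
  because the zero measure is always a competitor. This is what makes all later constants independent
  of the run of the algorithm.\<close>

lemma dual_iterates_bounded:
  fixes a :: "'m::finite \<Rightarrow> real ^ 'd::finite \<Rightarrow> real"
  assumes a: "\<And>m. continuous_on Cube (a m)"
    and lip: "L-lipschitz_on UNIV gradf" and coer: "coercive_objective a f"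
  shows "\<exists>Q. \<forall>V F w. finite F \<longrightarrow> F \<subseteq> V \<longrightarrow> V \<subseteq> Cube \<longrightarrow> primal_solution a f V (comb F w) \<longrightarrow>
      norm (gradf (A_op a (comb F w))) \<le> Q"
proof -
  obtain r where r: "\<And>\<mu>. \<mu> \<in> measures_on Cube \<Longrightarrow> r \<le> tv_norm \<mu> \<Longrightarrow> f 0 + 1 \<le> objective a f \<mu>"
    using coer unfolding coercive_objective_def by meson
  have "compact ((\<lambda>x. \<chi> m. a m x) ` Cube)"
    by (intro compact_continuous_image compact_Cube continuous_on_vec_lambda a)
  then obtain N where N: "\<And>x. x \<in> Cube \<Longrightarrow> norm (\<chi> m. a m x) \<le> N" and N0: "N > 0"
    using compact_imp_bounded bounded_pos by (metis image_eqI)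
  have L: "L \<ge> 0" using lip lipschitz_on_nonneg by blast
  show ?thesis
  proof (intro exI allI impI)
    fix V F and w :: "real ^ 'd \<Rightarrow> real"
    assume F: "finite F" "F \<subseteq> V" and V: "V \<subseteq> Cube" and opt: "primal_solution a f V (comb F w)"
    have FC: "F \<subseteq> Cube" using F V by blast
    have "objective a f (comb F w) \<le> objective a f (comb {} w)"
      using opt comb_measures_on[of "{}" V w] unfolding primal_solution_def by blast
    also have "\<dots> = f 0" by (simp add: objective_def tv_norm_comb A_op_comb[OF a])
    finally have "tv_norm (comb F w) < r"
      using r[OF comb_measures_on[OF F(1) FC], of w] by linarith
    then have T: "(\<Sum>v\<in>F. \<bar>w v\<bar>) \<le> r" by (simp add: tv_norm_comb[OF F(1)])
    have "norm (A_op a (comb F w)) \<le> (\<Sum>v\<in>F. norm (w v *\<^sub>R (\<chi> m. a m v)))"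
      unfolding A_op_comb[OF a F(1) FC] by (rule norm_sum)
    also have "\<dots> \<le> (\<Sum>v\<in>F. \<bar>w v\<bar> * N)"
      using N FC by (intro sum_mono) (auto intro!: mult_left_mono)
    also have "\<dots> \<le> r * N"
      unfolding sum_distrib_right[symmetric] using T N0 by (intro mult_right_mono) auto
    finally have y: "norm (A_op a (comb F w)) \<le> r * N" .
    have "norm (gradf (A_op a (comb F w)) - gradf 0) \<le> L * norm (A_op a (comb F w))"
      using lipschitz_onD[OF lip, of "A_op a (comb F w)" 0] by (simp add: dist_norm)
    also have "\<dots> \<le> L * (r * N)" using y L by (rule mult_left_mono)
    finally show "norm (gradf (A_op a (comb F w))) \<le> norm (gradf 0) + L * (r * N)"
      using norm_triangle_sub[of "gradf (A_op a (comb F w))" "gradf 0"] by linarith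
  qed
qed

lemma dirac_comb_eq_comb:
  "\<exists>w. dirac_comb S \<alpha> x = comb (x ` {1..S}) w"
proof
  show "dirac_comb S \<alpha> x = comb (x ` {1..S}) (\<lambda>v. \<Sum>s\<in>{s\<in>{1..S}. x s = v}. \<alpha> s)"
  proof
    fix E
    have "(\<Sum>s\<in>{1..S}. \<alpha> s * indicator E (x s)) =
        (\<Sum>v\<in>x ` {1..S}. \<Sum>s\<in>{s\<in>{1..S}. x s = v}. \<alpha> s * indicator E (x s))"
      by (rule sum.image_gen) simp
    also have "\<dots> = (\<Sum>v\<in>x ` {1..S}. (\<Sum>s\<in>{s\<in>{1..S}. x s = v}. \<alpha> s) * indicator E v)"
      unfolding sum_distrib_right by (intro sum.cong) auto
    finally show "dirac_comb S \<alpha> x E = comb (x ` {1..S}) (\<lambda>v. \<Sum>s\<in>{s\<in>{1..S}. x s = v}. \<alpha> s) E"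
      by (simp add: dirac_comb_def comb_def)
  qed
qed

section \<open>Calculus on the closed cube\<close>

definition grad :: "(real ^ 'd::finite) set \<Rightarrow> (real ^ 'd \<Rightarrow> real) \<Rightarrow> real ^ 'd \<Rightarrow> real ^ 'd" where
  "grad X g x = (\<chi> i. partial X i g x)"

text \<open>Derivatives within the cube are unique even at its boundary, since the cube has nonempty interior;
  hence the \<open>SOME\<close> hidden in \<open>frechet_derivative\<close> is harmless.\<close>

lemma partial_Cube:
  assumes "(g has_derivative g') (at x within Cube)" "x \<in> Cube"
  shows "partial Cube i g x = g' (axis i 1)"
proof -
  have "frechet_derivative g (at x within Cube) = g'"
    unfolding Cube_def
  proof (rule frechet_derivative_within_cbox)
    fix b :: "real ^ 'a" assume "b \<in> Basis"
    then obtain i where "b = axis i 1" by (auto simp: Basis_vec_def)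
    then show "0 \<bullet> b < (\<chi> i. 1) \<bullet> b" by (simp add: inner_axis)
  qed (use assms in \<open>auto simp: Cube_def\<close>)
  then show ?thesis by (simp add: partial_def)
qed

lemma has_derivative_grad:
  assumes "g differentiable_on Cube" "x \<in> Cube"
  shows "(g has_derivative (\<lambda>h. h \<bullet> grad Cube g x)) (at x within Cube)"
proof -
  obtain g' where g': "(g has_derivative g') (at x within Cube)"
    using assms unfolding differentiable_on_def differentiable_def by blast
  have lin: "linear g'" using g' has_derivative_linear by blast
  have "g' h = h \<bullet> grad Cube g x" for h
  proof -
    have "g' h = g' (\<Sum>i\<in>UNIV. (h $ i) *\<^sub>R axis i 1)"
      using basis_expansion[of h] by (simp add: scalar_mult_eq_scaleR)
    also have "\<dots> = (\<Sum>i\<in>UNIV. h $ i * g' (axis i 1))"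
      by (simp add: linear_sum[OF lin] linear_scale[OF lin])
    also have "\<dots> = h \<bullet> grad Cube g x"
      by (simp add: inner_vec_def grad_def partial_Cube[OF g' assms(2)])
    finally show ?thesis .
  qed
  then have "g' = (\<lambda>h. h \<bullet> grad Cube g x)" by blast
  then show ?thesis using g' by simp
qed

lemma partial_Cube_cong:
  assumes "g differentiable_on Cube" "\<And>y. y \<in> Cube \<Longrightarrow> h y = g y" "x \<in> Cube"
  shows "partial Cube i h x = partial Cube i g x"
proof -
  obtain g' where g': "(g has_derivative g') (at x within Cube)"
    using assms unfolding differentiable_on_def differentiable_def by blast
  then have "(h has_derivative g') (at x within Cube)"
    using assms by (intro has_derivative_transform[where f = g and g = h]) auto
  then show ?thesis using partial_Cube assms(3) g' by metis
qed

lemma A_adj_has_derivative: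
  assumes "\<And>m. b m differentiable_on Cube" "x \<in> Cube"
  shows "(A_adj b q has_derivative (\<lambda>h. \<Sum>m\<in>UNIV. q $ m * (h \<bullet> grad Cube (b m) x))) (at x within Cube)"
  unfolding A_adj_def[abs_def]
  by (intro has_derivative_sum has_derivative_mult_right has_derivative_grad assms)

lemma A_adj_differentiable_on:
  assumes "\<And>m. b m differentiable_on Cube"
  shows "A_adj b q differentiable_on Cube"
  unfolding differentiable_on_def differentiable_def using A_adj_has_derivative[of b, OF assms] by blast

text \<open>Partial derivatives of \<open>A_adj b q\<close> are again of the form \<open>A_adj b' q\<close>, so that regularity, linearity in
  \<open>q\<close> and uniform bounds all follow from those of \<open>A_adj\<close> itself.\<close>

lemma partial_A_adj:
  assumes "\<And>m. b m differentiable_on Cube" "x \<in> Cube"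
  shows "partial Cube i (A_adj b q) x = A_adj (\<lambda>m. partial Cube i (b m)) q x"
  using partial_Cube[OF A_adj_has_derivative[of b, OF assms] assms(2), of i]
  by (simp add: A_adj_def grad_def inner_axis')

lemma partial_partial_A_adj:
  assumes C2: "\<And>m. C2_on Cube (a m)" and x: "x \<in> Cube"
  shows "partial Cube i (partial Cube j (A_adj a q)) x =
    A_adj (\<lambda>m. partial Cube i (partial Cube j (a m))) q x"
proof -
  have d: "a m differentiable_on Cube" "partial Cube j (a m) differentiable_on Cube" for m
    using C2[of m] by (auto simp: C2_on_def)
  have "partial Cube i (partial Cube j (A_adj a q)) x =
      partial Cube i (A_adj (\<lambda>m. partial Cube j (a m)) q) x"
  proof (rule partial_Cube_cong)
    show "A_adj (\<lambda>m. partial Cube j (a m)) q differentiable_on Cube"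
      by (rule A_adj_differentiable_on[of "\<lambda>m. partial Cube j (a m)", OF d(2)])
    show "partial Cube j (A_adj a q) y = A_adj (\<lambda>m. partial Cube j (a m)) q y" if "y \<in> Cube" for y
      by (rule partial_A_adj[of a, OF d(1) that])
  qed (rule x)
  then show ?thesis using partial_A_adj[of "\<lambda>m. partial Cube j (a m)", OF d(2) x] by simp
qed

lemma C2_on_A_adj:
  fixes a :: "'m::finite \<Rightarrow> real ^ 'd::finite \<Rightarrow> real"
  assumes C2: "\<And>m. C2_on Cube (a m)"
  shows "C2_on Cube (A_adj a q)"
proof -
  have d: "a m differentiable_on Cube" "partial Cube j (a m) differentiable_on Cube" for m j
    using C2[of m] by (auto simp: C2_on_def)
  have c: "continuous_on Cube (partial Cube i (partial Cube j (a m)))" for i j m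
    using C2[of m] by (auto simp: C2_on_def)
  have "partial Cube i (A_adj a q) differentiable_on Cube" for i
  proof -
    have "A_adj (\<lambda>m. partial Cube i (a m)) q differentiable_on Cube"
      by (intro A_adj_differentiable_on d)
    show ?thesis
      unfolding differentiable_on_def differentiable_def
    proof
      fix x :: "real ^ 'd" assume x: "x \<in> Cube"
      then obtain g' where g': "(A_adj (\<lambda>m. partial Cube i (a m)) q has_derivative g') (at x within Cube)"
        using \<open>A_adj (\<lambda>m. partial Cube i (a m)) q differentiable_on Cube\<close>
        unfolding differentiable_on_def differentiable_def by blast
      have eq: "partial Cube i (A_adj a q) y = A_adj (\<lambda>m. partial Cube i (a m)) q y" if "y \<in> Cube" for y
        by (rule partial_A_adj[of a, OF d(1) that])
      have "(partial Cube i (A_adj a q) has_derivative g') (at x within Cube)"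
        by (rule has_derivative_transform[OF x eq g'])
      then show "\<exists>g'. (partial Cube i (A_adj a q) has_derivative g') (at x within Cube)" by blast
    qed
  qed
  moreover have "continuous_on Cube (partial Cube i (partial Cube j (A_adj a q)))" for i j
    using continuous_on_A_adj[of Cube "\<lambda>m. partial Cube i (partial Cube j (a m))", OF c, of q]
    by (rule continuous_on_eq) (rule partial_partial_A_adj[of a, OF C2, symmetric])
  ultimately show ?thesis
    unfolding C2_on_def using A_adj_differentiable_on[of a, OF d(1)] by blast
qed

lemma grad_A_adj_add:
  assumes "\<And>m. b m differentiable_on Cube" "x \<in> Cube"
  shows "grad Cube (A_adj b (p + q)) x = grad Cube (A_adj b p) x + grad Cube (A_adj b q) x"
  using assms by (simp add: grad_def vec_eq_iff partial_A_adj A_adj_def distrib_right sum.distrib)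

lemma hessian_A_adj_add:
  assumes "\<And>m. C2_on Cube (a m)" "x \<in> Cube"
  shows "hessian Cube (A_adj a (p + q)) x = hessian Cube (A_adj a p) x + hessian Cube (A_adj a q) x"
  using assms
  by (simp add: hessian_def vec_eq_iff partial_partial_A_adj A_adj_def distrib_right sum.distrib)

lemma hessian_A_adj_scaleR:
  assumes "\<And>m. C2_on Cube (a m)" "x \<in> Cube"
  shows "hessian Cube (A_adj a (c *\<^sub>R q)) x = c *\<^sub>R hessian Cube (A_adj a q) x"
  using assms
  by (simp add: hessian_def vec_eq_iff partial_partial_A_adj A_adj_def sum_distrib_left mult.assoc)

lemma A_adj_bounded:
  assumes "\<And>m. continuous_on Cube (b m)"
  shows "\<exists>N\<ge>0. \<forall>q. \<forall>x\<in>Cube. \<bar>A_adj b q x\<bar> \<le> N * norm q"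
proof -
  have "compact ((\<lambda>x. \<chi> m. b m x) ` Cube)"
    by (intro compact_continuous_image compact_Cube continuous_on_vec_lambda assms)
  then obtain N where N: "\<And>x. x \<in> Cube \<Longrightarrow> norm (\<chi> m. b m x) \<le> N" and N0: "N > 0"
    using compact_imp_bounded bounded_pos by (metis image_eqI)
  have "\<bar>A_adj b q x\<bar> \<le> N * norm q" if "x \<in> Cube" for q x
    unfolding A_adj_inner
    by (rule order_trans[OF Cauchy_Schwarz_ineq2], subst mult.commute)
      (intro mult_right_mono N that norm_ge_zero)
  then show ?thesis using N0 by (intro exI[of _ N]) auto
qed

lemma A_adj_derivatives_bounded:
  fixes a :: "'m::finite \<Rightarrow> real ^ 'd::finite \<Rightarrow> real"
  assumes C2: "\<And>m. C2_on Cube (a m)"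
  shows "\<exists>B>0. \<forall>q. \<forall>x\<in>Cube. \<forall>h. \<bar>A_adj a q x\<bar> \<le> B * norm q \<and>
    \<bar>h \<bullet> grad Cube (A_adj a q) x\<bar> \<le> B * norm q * norm h \<and>
    \<bar>h \<bullet> (hessian Cube (A_adj a q) x *v h)\<bar> \<le> B * norm q * (norm h)\<^sup>2"
proof -
  have d: "a m differentiable_on Cube" "partial Cube j (a m) differentiable_on Cube" for m j
    using C2[of m] by (auto simp: C2_on_def)
  have c: "continuous_on Cube (partial Cube i (partial Cube j (a m)))" for i j m
    using C2[of m] by (auto simp: C2_on_def)
  obtain N0 where N0: "N0 \<ge> 0" "\<And>q x. x \<in> Cube \<Longrightarrow> \<bar>A_adj a q x\<bar> \<le> N0 * norm q"
    using A_adj_bounded[of a] differentiable_imp_continuous_on[OF d(1)] by blast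
  have "\<exists>N\<ge>0. \<forall>q. \<forall>x\<in>Cube. \<bar>A_adj (\<lambda>m. partial Cube i (a m)) q x\<bar> \<le> N * norm q" for i
    by (intro A_adj_bounded differentiable_imp_continuous_on d)
  then obtain N1 where N1: "\<And>i. N1 i \<ge> 0"
    "\<And>i q x. x \<in> Cube \<Longrightarrow> \<bar>A_adj (\<lambda>m. partial Cube i (a m)) q x\<bar> \<le> N1 i * norm q"
    by metis
  have "\<exists>N\<ge>0. \<forall>q. \<forall>x\<in>Cube.
      \<bar>A_adj (\<lambda>m. partial Cube i (partial Cube j (a m))) q x\<bar> \<le> N * norm q" for i j
    by (intro A_adj_bounded c)
  then obtain N2 where N2: "\<And>i j. N2 i j \<ge> 0"
    "\<And>i j q x. x \<in> Cube \<Longrightarrow>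
      \<bar>A_adj (\<lambda>m. partial Cube i (partial Cube j (a m))) q x\<bar> \<le> N2 i j * norm q"
    by metis
  define B1 where "B1 = (\<Sum>i\<in>UNIV. N1 i)"
  define B2 where "B2 = (\<Sum>i\<in>UNIV. \<Sum>j\<in>UNIV. N2 i j)"
  define B where "B = 1 + N0 + B1 + B2"
  have nn: "B1 \<ge> 0" "B2 \<ge> 0" using N1(1) N2(1) by (auto simp: B1_def B2_def intro!: sum_nonneg)
  have "\<bar>A_adj a q x\<bar> \<le> B * norm q \<and> \<bar>h \<bullet> grad Cube (A_adj a q) x\<bar> \<le> B * norm q * norm h \<and>
    \<bar>h \<bullet> (hessian Cube (A_adj a q) x *v h)\<bar> \<le> B * norm q * (norm h)\<^sup>2" if x: "x \<in> Cube" for q x h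
  proof (intro conjI)
    have "N0 * norm q \<le> B * norm q" using nn by (intro mult_right_mono) (auto simp: B_def)
    then show "\<bar>A_adj a q x\<bar> \<le> B * norm q" using N0(2)[OF x, of q] by linarith
    have "\<bar>h \<bullet> grad Cube (A_adj a q) x\<bar> \<le>
        (\<Sum>i\<in>UNIV. \<bar>h $ i * A_adj (\<lambda>m. partial Cube i (a m)) q x\<bar>)"
      unfolding inner_vec_def by (simp add: grad_def partial_A_adj[of a, OF d(1) x])
    also have "\<dots> \<le> (\<Sum>i\<in>UNIV. norm h * (N1 i * norm q))"
      unfolding abs_mult using N1 x
      by (intro sum_mono mult_mono component_le_norm_cart) auto
    also have "\<dots> = B1 * norm q * norm h"
      by (simp add: B1_def sum_distrib_left sum_distrib_right mult_ac)
    also have "\<dots> \<le> B * norm q * norm h"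
      using nn N0(1) by (intro mult_right_mono) (auto simp: B_def)
    finally show "\<bar>h \<bullet> grad Cube (A_adj a q) x\<bar> \<le> B * norm q * norm h" .
    have "h \<bullet> (hessian Cube (A_adj a q) x *v h) = (\<Sum>i\<in>UNIV. \<Sum>j\<in>UNIV.
        h $ i * (A_adj (\<lambda>m. partial Cube i (partial Cube j (a m))) q x * h $ j))"
      by (simp add: inner_vec_def matrix_vector_mult_def hessian_def
          partial_partial_A_adj[of a, OF C2 x] sum_distrib_left)
    also have "\<bar>\<dots>\<bar> \<le> (\<Sum>i\<in>UNIV. \<Sum>j\<in>UNIV.
        \<bar>h $ i * (A_adj (\<lambda>m. partial Cube i (partial Cube j (a m))) q x * h $ j)\<bar>)"
      by (rule order_trans[OF sum_abs]) (intro sum_mono sum_abs)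
    also have "\<dots> \<le> (\<Sum>i\<in>UNIV. \<Sum>j\<in>UNIV. norm h * ((N2 i j * norm q) * norm h))"
      unfolding abs_mult using N2 x
      by (intro sum_mono mult_mono component_le_norm_cart) auto
    also have "\<dots> = B2 * norm q * (norm h)\<^sup>2"
      by (simp add: B2_def sum_distrib_left sum_distrib_right power2_eq_square mult_ac)
    also have "\<dots> \<le> B * norm q * (norm h)\<^sup>2"
      using nn N0(1) by (intro mult_right_mono) (auto simp: B_def)
    finally show "\<bar>h \<bullet> (hessian Cube (A_adj a q) x *v h)\<bar> \<le> B * norm q * (norm h)\<^sup>2" .
  qed
  moreover have "B > 0" using nn N0(1) by (simp add: B_def)
  ultimately show ?thesis by blast
qed

text \<open>Taylor's formula on the unit interval with a one-sided bound on the second derivative. Only one-sided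
  derivatives are available at the end points, as the segment may touch the boundary of the cube.\<close>

lemma second_order_upper_bound_01:
  fixes \<phi> :: "real \<Rightarrow> real"
  assumes d1: "\<And>t. 0 \<le> t \<Longrightarrow> t \<le> 1 \<Longrightarrow> (\<phi> has_real_derivative \<phi>1 t) (at t within {0..1})"
    and d2: "\<And>t. 0 \<le> t \<Longrightarrow> t \<le> 1 \<Longrightarrow> (\<phi>1 has_real_derivative \<phi>2 t) (at t within {0..1})"
    and le: "\<And>t. 0 \<le> t \<Longrightarrow> t \<le> 1 \<Longrightarrow> \<phi>2 t \<le> c"
  shows "\<phi> 1 \<le> \<phi> 0 + \<phi>1 0 + c / 2"
proof -
  have \<phi>1: "\<phi>1 t \<le> \<phi>1 0 + c * t" if t: "0 < t" "t < 1" for t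
  proof -
    have "\<exists>s\<in>{0<..<t}. \<phi>1 t - \<phi>1 0 = (t - 0) * \<phi>2 s"
    proof (rule mvt_simple[OF t(1), where f' = "\<lambda>s u. u * \<phi>2 s"])
      fix s assume s: "0 \<le> s" "s \<le> t"
      then have "(\<phi>1 has_real_derivative \<phi>2 s) (at s within {0..t})"
        using t by (intro has_field_derivative_subset[OF d2]) auto
      then show "(\<phi>1 has_derivative (\<lambda>u. u * \<phi>2 s)) (at s within {0..t})"
        by (simp add: has_field_derivative_def mult.commute[of _ "\<phi>2 s"])
    qed
    then obtain s where s: "0 < s" "s < t" "\<phi>1 t - \<phi>1 0 = t * \<phi>2 s" by auto
    have "t * \<phi>2 s \<le> t * c" using le[of s] s t by (intro mult_left_mono) auto
    then show ?thesis using s(3) by (simp add: mult.commute)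
  qed
  define \<psi> where "\<psi> t = \<phi> t - \<phi>1 0 * t - c * t\<^sup>2 / 2" for t
  have "\<exists>s\<in>{0<..<1}. \<psi> 1 - \<psi> 0 = (1 - 0) * (\<phi>1 s - \<phi>1 0 - c * s)"
  proof (rule mvt_simple[where f' = "\<lambda>s u. u * (\<phi>1 s - \<phi>1 0 - c * s)"])
    fix s :: real assume s: "0 \<le> s" "s \<le> 1"
    have "(\<psi> has_real_derivative \<phi>1 s - \<phi>1 0 - c * s) (at s within {0..1})"
      unfolding \<psi>_def by (auto intro!: derivative_eq_intros d1 s)
    then show "(\<psi> has_derivative (\<lambda>u. u * (\<phi>1 s - \<phi>1 0 - c * s))) (at s within {0..1})"
      by (simp add: has_field_derivative_def mult.commute[of _ "\<phi>1 s - \<phi>1 0 - c * s"])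
  qed simp
  then obtain s where "0 < s" "s < 1" "\<psi> 1 - \<psi> 0 = \<phi>1 s - \<phi>1 0 - c * s" by auto
  then have "\<psi> 1 \<le> \<psi> 0" using \<phi>1[of s] by simp
  then show ?thesis by (simp add: \<psi>_def)
qed

lemma segment_in_Cube:
  assumes "x \<in> Cube" "x + h \<in> Cube" "0 \<le> t" "t \<le> 1"
  shows "x + t *\<^sub>R h \<in> Cube"
proof -
  have "(1 - t) *\<^sub>R x + t *\<^sub>R (x + h) \<in> Cube"
    using assms by (intro convexD convex_box) (auto simp: Cube_def)
  then show ?thesis by (simp add: algebra_simps)
qed

lemma C2_upper_bound:
  assumes C2: "C2_on Cube g" and x: "x \<in> Cube" "x + h \<in> Cube"
    and le: "\<And>t. 0 \<le> t \<Longrightarrow> t \<le> 1 \<Longrightarrow> h \<bullet> (hessian Cube g (x + t *\<^sub>R h) *v h) \<le> c"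
  shows "g (x + h) \<le> g x + h \<bullet> grad Cube g x + c / 2"
proof -
  have line: "((\<lambda>t. u (x + t *\<^sub>R h)) has_real_derivative h \<bullet> grad Cube u (x + t *\<^sub>R h)) (at t within {0..1})"
    if u: "u differentiable_on Cube" and t: "0 \<le> t" "t \<le> 1" for u t
  proof -
    have "((\<lambda>t. x + t *\<^sub>R h) has_derivative (\<lambda>s. s *\<^sub>R h)) (at t within {0..1})"
      by (auto intro!: derivative_eq_intros)
    moreover have "(u has_derivative (\<lambda>k. k \<bullet> grad Cube u (x + t *\<^sub>R h)))
        (at (x + t *\<^sub>R h) within (\<lambda>t. x + t *\<^sub>R h) ` {0..1})"
      using segment_in_Cube[OF x]
      by (intro has_derivative_subset[OF has_derivative_grad[OF u]]) (use t in auto)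
    ultimately have "((\<lambda>t. u (x + t *\<^sub>R h)) has_derivative (\<lambda>s. (s *\<^sub>R h) \<bullet> grad Cube u (x + t *\<^sub>R h)))
        (at t within {0..1})"
      by (rule has_derivative_in_compose)
    then show ?thesis
      by (simp add: has_field_derivative_def mult.commute[of _ "h \<bullet> grad Cube u (x + t *\<^sub>R h)"])
  qed
  have d: "g differentiable_on Cube" "partial Cube j g differentiable_on Cube" for j
    using C2 by (auto simp: C2_on_def)
  have hess: "(\<Sum>j\<in>UNIV. h $ j * (h \<bullet> grad Cube (partial Cube j g) z)) = h \<bullet> (hessian Cube g z *v h)" for z
    unfolding inner_vec_def hessian_def grad_def matrix_vector_mult_def sum_distrib_left
    by (subst sum.swap) (simp add: sum_distrib_left mult_ac)
  have "((\<lambda>t. h \<bullet> grad Cube g (x + t *\<^sub>R h)) has_real_derivative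
      h \<bullet> (hessian Cube g (x + t *\<^sub>R h) *v h)) (at t within {0..1})" if t: "0 \<le> t" "t \<le> 1" for t
  proof -
    have "((\<lambda>t. \<Sum>j\<in>UNIV. h $ j * partial Cube j g (x + t *\<^sub>R h)) has_real_derivative
        (\<Sum>j\<in>UNIV. h $ j * (h \<bullet> grad Cube (partial Cube j g) (x + t *\<^sub>R h)))) (at t within {0..1})"
      by (intro DERIV_sum DERIV_cmult line d t)
    then show ?thesis by (simp add: hess) (simp add: inner_vec_def grad_def)
  qed
  from second_order_upper_bound_01[OF line[OF d(1)] this le]
  show ?thesis by simp
qed

lemma grad_eq_0_at_interior_maximum:
  assumes g: "g differentiable_on Cube" and x: "x \<in> Cube" "x \<notin> frontier Cube"
    and max: "\<And>y. y \<in> Cube \<Longrightarrow> g y \<le> g x"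
  shows "grad Cube g x = 0"
proof -
  have "closed (Cube :: (real ^ 'a) set)" by (simp add: Cube_def closed_cbox)
  then have xi: "x \<in> interior Cube" using x by (simp add: frontier_def)
  have "(g has_derivative (\<lambda>h. h \<bullet> grad Cube g x)) (at x)"
    using has_derivative_grad[OF g x(1)] unfolding at_within_interior[OF xi] .
  moreover have "\<forall>y\<in>interior Cube. g y \<le> g x" using max interior_subset[of Cube] by blast
  ultimately have "(\<lambda>h. h \<bullet> grad Cube g x) = (\<lambda>h. 0)"
    by (intro differential_zero_maxmin[OF xi open_interior]) auto
  from fun_cong[OF this, of "grad Cube g x"] show ?thesis by simp
qed

section \<open>Counting refined cells\<close>

text \<open>The consequences of being a cell partition that counting rests on, in a form that refinement
  visibly preserves.\<close>

definition nonoverlapping :: "('d::finite) cell set \<Rightarrow> bool" where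
  "nonoverlapping W \<longleftrightarrow> finite W \<and> W \<noteq> {} \<and> (\<forall>\<omega>\<in>W. dyadic_cell \<omega>) \<and>
     pairwise (\<lambda>\<omega> \<omega>'. negligible (cell_set \<omega> \<inter> cell_set \<omega>')) W"

lemma edge_pos: "edge \<omega> > 0"
  by (simp add: edge_def)

lemma mem_Cube: "x \<in> Cube \<longleftrightarrow> (\<forall>i. 0 \<le> x $ i \<and> x $ i \<le> 1)"
  by (simp add: Cube_def mem_box_cart)

lemma mem_cell_set:
  "x \<in> cell_set \<omega> \<longleftrightarrow> (\<forall>i. corner \<omega> $ i \<le> x $ i \<and> x $ i \<le> corner \<omega> $ i + edge \<omega>)"
proof
  assume "x \<in> cell_set \<omega>"
  then obtain y where "y \<in> Cube" "x = corner \<omega> + edge \<omega> *\<^sub>R y" by (auto simp: cell_set_def)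
  then show "\<forall>i. corner \<omega> $ i \<le> x $ i \<and> x $ i \<le> corner \<omega> $ i + edge \<omega>"
    using edge_pos[of \<omega>] by (auto simp: mem_Cube mult_left_le)
next
  assume x: "\<forall>i. corner \<omega> $ i \<le> x $ i \<and> x $ i \<le> corner \<omega> $ i + edge \<omega>"
  define y where "y = (1 / edge \<omega>) *\<^sub>R (x - corner \<omega>)"
  have "y \<in> Cube" using x edge_pos[of \<omega>] by (auto simp: mem_Cube y_def field_simps)
  moreover have "x = corner \<omega> + edge \<omega> *\<^sub>R y" using edge_pos[of \<omega>] by (simp add: y_def)
  ultimately show "x \<in> cell_set \<omega>" by (auto simp: cell_set_def)
qed

lemma cell_set_cbox: "cell_set \<omega> = cbox (corner \<omega>) (\<chi> i. corner \<omega> $ i + edge \<omega>)"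
  by (auto simp: mem_cell_set mem_box_cart)

lemma cell_set_not_negligible: "\<not> negligible (cell_set \<omega>)"
proof -
  have "(\<chi> i. corner \<omega> $ i + edge \<omega> / 2) \<in> box (corner \<omega>) (\<chi> i. corner \<omega> $ i + edge \<omega>)"
    using edge_pos[of \<omega>] by (simp add: mem_box_cart)
  then show ?thesis unfolding cell_set_cbox negligible_interval by blast
qed

lemma cell_set_subset_Cube:
  assumes "dyadic_cell \<omega>" shows "cell_set \<omega> \<subseteq> Cube"
proof
  fix x assume x: "x \<in> cell_set \<omega>"
  have "corner \<omega> $ i + edge \<omega> \<le> 1" for i
  proof -
    have "snd \<omega> $ i < 2 ^ fst \<omega>" using assms by (auto simp: dyadic_cell_def split: prod.splits)
    then have "real (Suc (snd \<omega> $ i)) \<le> real (2 ^ fst \<omega>)" by (simp only: of_nat_le_iff)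
    then show ?thesis by (simp add: corner_def edge_def field_simps)
  qed
  moreover have "0 \<le> corner \<omega> $ i" for i by (simp add: corner_def edge_def)
  ultimately show "x \<in> Cube" using x unfolding mem_cell_set mem_Cube by (meson order_trans)
qed

lemma cell_vert_subset: "cell_vert \<omega> \<subseteq> cell_set \<omega>"
proof -
  have "{y::real^'a. \<forall>i. y $ i \<in> {0, 1}} \<subseteq> Cube"
  proof
    fix y :: "real^'a" assume "y \<in> {y. \<forall>i. y $ i \<in> {0, 1}}"
    then have "y $ i = 0 \<or> y $ i = 1" for i by auto
    then show "y \<in> Cube" unfolding mem_Cube by (metis order_refl zero_le_one)
  qed
  then show ?thesis unfolding cell_vert_def cell_set_def by (rule image_mono)
qed

lemma corner_in_cell_vert: "corner \<omega> \<in> cell_vert \<omega>"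
  unfolding cell_vert_def by (rule image_eqI[of _ _ 0]) auto

lemma norm_le_of_mem_cell_set:
  fixes \<omega> :: "('d::finite) cell"
  assumes "x \<in> cell_set \<omega>" "y \<in> cell_set \<omega>"
  shows "norm (x - y) \<le> real CARD('d) * edge \<omega>"
proof -
  have "norm (x - y) \<le> (\<Sum>i\<in>UNIV. \<bar>(x - y) $ i\<bar>)" by (rule norm_le_l1_cart)
  also have "\<dots> \<le> (\<Sum>i\<in>(UNIV :: 'd set). edge \<omega>)"
  proof (rule sum_mono)
    fix i
    show "\<bar>(x - y) $ i\<bar> \<le> edge \<omega>"
      using assms[unfolded mem_cell_set, rule_format, of i] by (auto simp: abs_le_iff)
  qed
  finally show ?thesis by simp
qed

lemma finite_cell_vert:
  fixes \<omega> :: "('d::finite) cell"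
  shows "finite (cell_vert \<omega>)" "card (cell_vert \<omega>) \<le> 2 ^ CARD('d)"
proof -
  have eq: "{y :: real ^ 'd. \<forall>i. y $ i \<in> {0, 1}} = vec_lambda ` (PiE UNIV (\<lambda>_. {0, 1}))"
  proof (intro equalityI subsetI)
    fix y :: "real ^ 'd" assume "y \<in> {y. \<forall>i. y $ i \<in> {0, 1}}"
    then have "(\<lambda>i. y $ i) \<in> PiE UNIV (\<lambda>_. {0, 1})" by auto
    then show "y \<in> vec_lambda ` (PiE UNIV (\<lambda>_. {0, 1}))" by (rule image_eqI[rotated]) simp
  qed (auto simp: PiE_iff)
  have f: "finite (PiE (UNIV :: 'd set) (\<lambda>_. {0, 1 :: real}))" by (intro finite_PiE) auto
  then show "finite (cell_vert \<omega>)" unfolding cell_vert_def eq by (intro finite_imageI)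
  have "card (cell_vert \<omega>) \<le> card (PiE (UNIV :: 'd set) (\<lambda>_. {0, 1 :: real}))"
    unfolding cell_vert_def eq by (rule order_trans[OF card_image_le card_image_le]) (use f in auto)
  then show "card (cell_vert \<omega>) \<le> 2 ^ CARD('d)" by (simp add: card_PiE numeral_2_eq_2)
qed

lemma finite_vert:
  fixes W :: "('d::finite) cell set"
  assumes "finite W"
  shows "finite (vert W)" "card (vert W) \<le> 2 ^ CARD('d) * card W"
proof -
  show "finite (vert W)" unfolding vert_def using assms finite_cell_vert by blast
  have "card (vert W) \<le> (\<Sum>\<omega>\<in>W. card (cell_vert \<omega>))"
    unfolding vert_def by (rule card_UN_le[OF assms])
  also have "\<dots> \<le> (\<Sum>\<omega>\<in>W. 2 ^ CARD('d))" by (intro sum_mono finite_cell_vert)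
  finally show "card (vert W) \<le> 2 ^ CARD('d) * card W" by (simp add: mult.commute)
qed

lemma finite_children:
  fixes \<omega> :: "('d::finite) cell"
  shows "finite (children \<omega>)" "card (children \<omega>) \<le> 2 ^ CARD('d)"
proof -
  have eq: "children \<omega> = (\<lambda>b. (Suc (fst \<omega>), \<chi> i. 2 * snd \<omega> $ i + b i)) ` (PiE UNIV (\<lambda>_. {0, 1}))"
    by (auto simp: children_def PiE_iff)
  have f: "finite (PiE (UNIV :: 'd set) (\<lambda>_. {0, 1 :: nat}))" by (intro finite_PiE) auto
  then show "finite (children \<omega>)" unfolding eq by (rule finite_imageI)
  have "card (children \<omega>) \<le> card (PiE (UNIV :: 'd set) (\<lambda>_. {0, 1 :: nat}))"
    unfolding eq using f by (rule card_image_le)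
  then show "card (children \<omega>) \<le> 2 ^ CARD('d)" by (simp add: card_PiE numeral_2_eq_2)
qed

lemma children_nonempty: "\<exists>c. c \<in> children \<omega>"
  unfolding children_def by (rule exI, rule CollectI, rule exI[of _ "\<lambda>_. 0"]) auto

lemma edge_child: "c \<in> children \<omega> \<Longrightarrow> edge c = edge \<omega> / 2"
  by (auto simp: children_def edge_def)

lemma corner_child:
  assumes "c \<in> children \<omega>"
  shows "\<exists>b. (\<forall>i. b i \<in> {0, 1}) \<and> c = (Suc (fst \<omega>), \<chi> i. 2 * snd \<omega> $ i + b i) \<and>
    (\<forall>i. corner c $ i = corner \<omega> $ i + real (b i) * (edge \<omega> / 2))"
  using assms edge_child[OF assms] unfolding children_def
  by (auto simp: corner_def edge_def field_simps)

lemma child_subset: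
  assumes "c \<in> children \<omega>" shows "cell_set c \<subseteq> cell_set \<omega>"
proof
  fix x assume x: "x \<in> cell_set c"
  obtain b where b: "\<And>i. b i \<in> {0, 1 :: nat}"
    "\<And>i. corner c $ i = corner \<omega> $ i + real (b i) * (edge \<omega> / 2)"
    using corner_child[OF assms] by blast
  show "x \<in> cell_set \<omega>" unfolding mem_cell_set
  proof
    fix i
    have "b i = 0 \<or> b i = 1" using b(1)[of i] by auto
    then show "corner \<omega> $ i \<le> x $ i \<and> x $ i \<le> corner \<omega> $ i + edge \<omega>"
      using x[unfolded mem_cell_set, rule_format, of i] b(2)[of i] edge_child[OF assms] edge_pos[of \<omega>]
      by auto
  qed
qed

lemma dyadic_child:
  assumes "c \<in> children \<omega>" "dyadic_cell \<omega>" shows "dyadic_cell c"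
proof -
  obtain b where b: "\<And>i. b i \<in> {0, 1 :: nat}" "c = (Suc (fst \<omega>), \<chi> i. 2 * snd \<omega> $ i + b i)"
    using corner_child[OF assms(1)] by blast
  have "2 * snd \<omega> $ i + b i < 2 ^ Suc (fst \<omega>)" for i
  proof -
    have "b i \<le> 1" using b(1)[of i] by auto
    moreover have "snd \<omega> $ i < 2 ^ fst \<omega>"
      using assms(2) by (auto simp: dyadic_cell_def split: prod.splits)
    ultimately show ?thesis by simp
  qed
  then show ?thesis by (simp add: dyadic_cell_def b(2))
qed

lemma siblings_negligible:
  assumes "c \<in> children \<omega>" "c' \<in> children \<omega>" "c \<noteq> c'"
  shows "negligible (cell_set c \<inter> cell_set c')"
proof -
  obtain b where b: "\<And>i. b i \<in> {0, 1 :: nat}" "c = (Suc (fst \<omega>), \<chi> i. 2 * snd \<omega> $ i + b i)"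
    "\<And>i. corner c $ i = corner \<omega> $ i + real (b i) * (edge \<omega> / 2)"
    using corner_child[OF assms(1)] by blast
  obtain b' where b': "\<And>i. b' i \<in> {0, 1 :: nat}" "c' = (Suc (fst \<omega>), \<chi> i. 2 * snd \<omega> $ i + b' i)"
    "\<And>i. corner c' $ i = corner \<omega> $ i + real (b' i) * (edge \<omega> / 2)"
    using corner_child[OF assms(2)] by blast
  have "b \<noteq> b'" using assms(3) b(2) b'(2) by auto
  then obtain i where i: "b i \<noteq> b' i" by blast
  have bb: "b i = 0 \<and> b' i = 1 \<or> b i = 1 \<and> b' i = 0" using i b(1)[of i] b'(1)[of i] by auto
  have "cell_set c \<inter> cell_set c' \<subseteq> {x. x \<bullet> axis i 1 = corner \<omega> $ i + edge \<omega> / 2}"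
  proof
    fix x assume "x \<in> cell_set c \<inter> cell_set c'"
    then have x: "x \<in> cell_set c" "x \<in> cell_set c'" by auto
    show "x \<in> {x. x \<bullet> axis i 1 = corner \<omega> $ i + edge \<omega> / 2}"
      using x[unfolded mem_cell_set, THEN spec, of i] bb b(3)[of i] b'(3)[of i]
        edge_child[OF assms(1)] edge_child[OF assms(2)]
      by (auto simp: inner_axis)
  qed
  moreover have "negligible {x :: real ^ 'a. x \<bullet> axis i 1 = corner \<omega> $ i + edge \<omega> / 2}"
    by (rule negligible_standard_hyperplane) (auto simp: Basis_vec_def)
  ultimately show ?thesis using negligible_subset by blast
qed

lemma diameter_cell_set:
  fixes \<omega> :: "('d::finite) cell"
  shows "diameter (cell_set \<omega>) = edge \<omega> * norm ((\<chi> i. 1) :: real ^ 'd)"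
proof -
  have "diameter (cell_set \<omega>) = dist (corner \<omega>) (\<chi> i. corner \<omega> $ i + edge \<omega>)"
    unfolding cell_set_cbox
  proof (rule diameter_cbox, rule ballI)
    fix k :: "real ^ 'd" assume "k \<in> Basis"
    then obtain i where "k = axis i 1" by (auto simp: Basis_vec_def)
    then show "corner \<omega> \<bullet> k \<le> (\<chi> i. corner \<omega> $ i + edge \<omega>) \<bullet> k"
      using edge_pos[of \<omega>] by (simp add: inner_axis)
  qed
  also have "\<dots> = norm (edge \<omega> *\<^sub>R ((\<chi> i. 1) :: real ^ 'd))"
    unfolding dist_norm by (subst norm_minus_commute, rule arg_cong[where f = norm])
      (simp add: vec_eq_iff)
  finally show ?thesis using edge_pos[of \<omega>] by (simp only: norm_scaleR abs_of_pos)
qed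

text \<open>The diameter is a fixed multiple of the edge length, so largest cells are those of lowest level.\<close>

lemma largest_cells_eq: "largest_cells W = {\<omega> \<in> W. \<forall>\<omega>'\<in>W. fst \<omega> \<le> fst \<omega>'}"
proof -
  have "(\<chi> i. 1) \<noteq> (0 :: real ^ 'a)" by (simp add: vec_eq_iff)
  then have "diameter (cell_set \<omega>') \<le> diameter (cell_set \<omega>) \<longleftrightarrow> fst \<omega> \<le> fst \<omega>'"
    for \<omega> \<omega>' :: "'a cell"
    by (simp add: diameter_cell_set edge_def field_simps)
  then show ?thesis by (simp add: largest_cells_def)
qed

lemma largest_cells_nonempty:
  assumes "W \<noteq> {}" shows "\<exists>\<omega>. \<omega> \<in> largest_cells W"
proof -
  obtain \<omega> where "\<omega> \<in> W" "\<And>\<omega>'. \<omega>' \<in> W \<Longrightarrow> fst \<omega> \<le> fst \<omega>'"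
    using assms exists_least_iff[of "\<lambda>n. \<exists>\<omega>\<in>W. fst \<omega> = n"]
    by (metis all_not_in_conv not_le)
  then have "\<omega> \<in> largest_cells W" by (simp add: largest_cells_eq)
  then show ?thesis by blast
qed

text \<open>Two new cells either have different origins, and then overlap no more than these do, or are siblings.\<close>

lemma nonoverlapping_refine:
  assumes W: "nonoverlapping W" and C: "C \<subseteq> W"
  shows "nonoverlapping (refine W C)"
proof -
  let ?L = "largest_cells C"
  have L: "?L \<subseteq> W" using C by (auto simp: largest_cells_def)
  have fin: "finite W" "finite ?L" using W L finite_subset by (auto simp: nonoverlapping_def)
  have pw: "negligible (cell_set \<omega> \<inter> cell_set \<omega>')" if "\<omega> \<in> W" "\<omega>' \<in> W" "\<omega> \<noteq> \<omega>'" for \<omega> \<omega>'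
    using W that by (auto simp: nonoverlapping_def pairwise_def)
  \<comment> \<open>each new cell has an origin in \<open>W\<close>, and only siblings share their origin\<close>
  have origin: "\<exists>\<eta>\<in>W. cell_set c \<subseteq> cell_set \<eta> \<and> (c = \<eta> \<and> \<eta> \<notin> ?L \<or> \<eta> \<in> ?L \<and> c \<in> children \<eta>)"
    if "c \<in> refine W C" for c
    using that L child_subset unfolding refine_def by blast
  have "negligible (cell_set c \<inter> cell_set c')"
    if c: "c \<in> refine W C" "c' \<in> refine W C" "c \<noteq> c'" for c c'
  proof -
    obtain \<eta> where \<eta>: "\<eta> \<in> W" "cell_set c \<subseteq> cell_set \<eta>"
      "c = \<eta> \<and> \<eta> \<notin> ?L \<or> \<eta> \<in> ?L \<and> c \<in> children \<eta>" using origin[OF c(1)] by blast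
    obtain \<eta>' where \<eta>': "\<eta>' \<in> W" "cell_set c' \<subseteq> cell_set \<eta>'"
      "c' = \<eta>' \<and> \<eta>' \<notin> ?L \<or> \<eta>' \<in> ?L \<and> c' \<in> children \<eta>'" using origin[OF c(2)] by blast
    show ?thesis
    proof (cases "\<eta> = \<eta>'")
      case True
      then show ?thesis using \<eta>(3) \<eta>'(3) c(3) siblings_negligible by blast
    next
      case False
      have "cell_set c \<inter> cell_set c' \<subseteq> cell_set \<eta> \<inter> cell_set \<eta>'" using \<eta>(2) \<eta>'(2) by blast
      then show ?thesis using pw[OF \<eta>(1) \<eta>'(1) False] negligible_subset by blast
    qed
  qed
  moreover have "finite (refine W C)"
    unfolding refine_def using fin finite_children(1) by blast
  moreover have "refine W C \<noteq> {}"
  proof (cases "?L = {}")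
    case True then show ?thesis using W by (simp add: refine_def nonoverlapping_def)
  next
    case False then show ?thesis using children_nonempty unfolding refine_def by blast
  qed
  moreover have "\<forall>c\<in>refine W C. dyadic_cell c"
    using W L dyadic_child unfolding refine_def nonoverlapping_def by blast
  ultimately show ?thesis unfolding nonoverlapping_def pairwise_def by blast
qed

lemma cell_partition_nonoverlapping:
  assumes "cell_partition W" shows "nonoverlapping W"
proof -
  have "(0 :: real ^ 'a) \<in> Cube" by (simp add: mem_Cube)
  then have "W \<noteq> {}" using assms unfolding cell_partition_def by blast
  then show ?thesis using assms unfolding cell_partition_def nonoverlapping_def by blast
qed

lemma nonoverlapping_iterates:
  assumes "cell_partition (\<Omega> 0)" "\<And>k. C k \<subseteq> \<Omega> k" "\<And>k. \<Omega> (Suc k) = refine (\<Omega> k) (C k)"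
  shows "nonoverlapping (\<Omega> k)"
  by (induction k) (simp_all add: assms cell_partition_nonoverlapping nonoverlapping_refine)

lemma refined_has_descendant:
  assumes step: "\<And>k. \<Omega> (Suc k) = refine (\<Omega> k) (C k)"
    and \<omega>: "\<omega> \<in> largest_cells (C i)" and ik: "Suc i \<le> k"
  shows "\<exists>\<eta>\<in>\<Omega> k. cell_set \<eta> \<subseteq> cell_set \<omega> \<and> fst \<omega> < fst \<eta>"
  using ik
proof (induction k rule: dec_induct)
  case base
  obtain c where c: "c \<in> children \<omega>" using children_nonempty by blast
  then have "c \<in> \<Omega> (Suc i)" using \<omega> by (auto simp: step refine_def)
  moreover have "fst \<omega> < fst c" using c by (auto simp: children_def)
  ultimately show ?case using child_subset[OF c] by blast
next
  case (step k)
  then obtain \<eta> where \<eta>: "\<eta> \<in> \<Omega> k" "cell_set \<eta> \<subseteq> cell_set \<omega>" "fst \<omega> < fst \<eta>" by blast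
  show ?case
  proof (cases "\<eta> \<in> largest_cells (C k)")
    case True
    obtain c where c: "c \<in> children \<eta>" using children_nonempty by blast
    then have "c \<in> \<Omega> (Suc k)" using True by (auto simp: assms(1) refine_def)
    moreover have "fst \<omega> < fst c" using c \<eta>(3) by (auto simp: children_def)
    ultimately show ?thesis using child_subset[OF c] \<eta>(2) by blast
  next
    case False
    then have "\<eta> \<in> \<Omega> (Suc k)" using \<eta>(1) by (simp add: assms(1) refine_def)
    then show ?thesis using \<eta> by blast
  qed
qed

text \<open>No cell is refined twice: once refined, it always contains a strictly smaller cell of the current
  collection, and so cannot itself belong to this nonoverlapping collection again.\<close>

lemma refined_cells_disjoint:
  assumes init: "cell_partition (\<Omega> 0)" and sub: "\<And>k. C k \<subseteq> \<Omega> k"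
    and step: "\<And>k. \<Omega> (Suc k) = refine (\<Omega> k) (C k)"
  shows "disjoint_family (\<lambda>k. largest_cells (C k))"
proof -
  have "\<omega> \<notin> largest_cells (C k)" if ik: "i < k" and \<omega>: "\<omega> \<in> largest_cells (C i)" for i k \<omega>
  proof
    assume "\<omega> \<in> largest_cells (C k)"
    then have k: "\<omega> \<in> \<Omega> k" using sub by (auto simp: largest_cells_def)
    obtain \<eta> where \<eta>: "\<eta> \<in> \<Omega> k" "cell_set \<eta> \<subseteq> cell_set \<omega>" "fst \<omega> < fst \<eta>"
      using refined_has_descendant[of \<Omega> C, OF step \<omega>, of k] ik by auto
    have "nonoverlapping (\<Omega> k)" by (rule nonoverlapping_iterates[of \<Omega> C, OF init sub step])
    moreover have "\<eta> \<noteq> \<omega>" using \<eta>(3) by blast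
    ultimately have "negligible (cell_set \<eta> \<inter> cell_set \<omega>)"
      using k \<eta>(1) unfolding nonoverlapping_def pairwise_def by blast
    then show False using cell_set_not_negligible[of \<eta>] \<eta>(2) by (simp add: Int_absorb2)
  qed
  then show ?thesis
    unfolding disjoint_family_on_def by (metis disjoint_iff linorder_neqE_nat)
qed

lemma card_iterate_le:
  fixes \<Omega> :: "nat \<Rightarrow> ('d::finite) cell set"
  assumes init: "cell_partition (\<Omega> 0)" and sub: "\<And>k. C k \<subseteq> \<Omega> k"
    and step: "\<And>k. \<Omega> (Suc k) = refine (\<Omega> k) (C k)"
  shows "card (\<Omega> k) \<le> card (\<Omega> 0) + 2 ^ CARD('d) * card (\<Union>i<k. largest_cells (C i))"
proof -
  have fin: "finite (\<Omega> k)" for k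
    using nonoverlapping_iterates[of \<Omega> C, OF init sub step] by (simp add: nonoverlapping_def)
  have finL: "finite (largest_cells (C k))" for k
    by (rule finite_subset[OF _ fin[of k]]) (use sub[of k] in \<open>auto simp: largest_cells_def\<close>)
  have "card (\<Omega> k) \<le> card (\<Omega> 0) + 2 ^ CARD('d) * (\<Sum>i<k. card (largest_cells (C i)))"
  proof (induction k)
    case (Suc k)
    have "card (\<Omega> (Suc k)) \<le> card (\<Omega> k - largest_cells (C k)) +
        card (\<Union>\<omega>\<in>largest_cells (C k). children \<omega>)"
      unfolding step refine_def by (rule card_Un_le)
    also have "\<dots> \<le> card (\<Omega> k) + (\<Sum>\<omega>\<in>largest_cells (C k). card (children \<omega>))"
      by (intro add_mono card_UN_le finL card_mono fin) auto
    also have "\<dots> \<le> card (\<Omega> k) + (\<Sum>\<omega>\<in>largest_cells (C k). 2 ^ CARD('d))"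
      by (intro add_mono sum_mono finite_children order_refl)
    finally show ?case using Suc by (simp add: algebra_simps)
  qed simp
  moreover have "card (\<Union>i<k. largest_cells (C i)) = (\<Sum>i<k. card (largest_cells (C i)))"
    using refined_cells_disjoint[of \<Omega> C, OF init sub step]
    by (intro card_UN_disjoint) (auto simp: finL disjoint_family_on_def)
  ultimately show ?thesis by simp
qed

lemma card_nat_interval_le:
  "finite {n::nat. \<bar>real n - X\<bar> \<le> U}" "card {n::nat. \<bar>real n - X\<bar> \<le> U} \<le> nat \<lfloor>2 * U\<rfloor> + 1"
proof -
  let ?A = "{n::nat. \<bar>real n - X\<bar> \<le> U}"
  have *: "finite ?A \<and> card ?A \<le> nat \<lfloor>2 * U\<rfloor> + 1"
  proof (cases "?A = {}")
    case True then show ?thesis by (metis card.empty finite.emptyI zero_le)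
  next
    case False
    define m where "m = (LEAST n. n \<in> ?A)"
    have m: "m \<in> ?A" using False unfolding m_def by (metis (no_types, lifting) LeastI_ex ex_in_conv)
    have "?A \<subseteq> {m..m + nat \<lfloor>2 * U\<rfloor>}"
    proof
      fix n assume n: "n \<in> ?A"
      have "m \<le> n" unfolding m_def using n by (rule Least_le)
      moreover have "real n - real m \<le> 2 * U" using n m by auto
      then have "int (n - m) \<le> \<lfloor>2 * U\<rfloor>" using \<open>m \<le> n\<close> by (simp add: le_floor_iff of_nat_diff)
      ultimately show "n \<in> {m..m + nat \<lfloor>2 * U\<rfloor>}" by auto
    qed
    then show ?thesis using finite_subset card_mono[of "{m..m + nat \<lfloor>2 * U\<rfloor>}" ?A] by auto
  qed
  show "finite ?A" "card ?A \<le> nat \<lfloor>2 * U\<rfloor> + 1" using * by auto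
qed

text \<open>At level \<open>j\<close> the distance \<open>U / 2 ^ j\<close> is \<open>U\<close> edge lengths, whence the bound is the same on all levels.\<close>

lemma card_cells_near_point:
  fixes p :: "real ^ 'd::finite" and U :: real and j :: nat
  defines "N \<equiv> {\<omega>. fst \<omega> = j \<and> (\<exists>x\<in>cell_set \<omega>. norm (x - p) \<le> U / 2 ^ j)}"
  shows "finite N" "card N \<le> (nat \<lfloor>2 * (U + 1)\<rfloor> + 1) ^ CARD('d)"
proof -
  define A where "A i = {n::nat. \<bar>real n - 2 ^ j * p $ i\<bar> \<le> U + 1}" for i
  have A: "finite (A i)" "card (A i) \<le> nat \<lfloor>2 * (U + 1)\<rfloor> + 1" for i
    unfolding A_def by (rule card_nat_interval_le)+
  have fP: "finite (PiE UNIV A)" using A by (intro finite_PiE) auto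
  have sub: "N \<subseteq> (\<lambda>n. (j, vec_lambda n)) ` PiE UNIV A"
  proof
    fix \<omega> assume "\<omega> \<in> N"
    then obtain x where w: "fst \<omega> = j" "x \<in> cell_set \<omega>" "norm (x - p) \<le> U / 2 ^ j"
      by (auto simp: N_def)
    have "snd \<omega> $ i \<in> A i" for i
    proof -
      have e: "edge \<omega> = 1 / 2 ^ j" by (simp add: edge_def w(1))
      have c: "corner \<omega> $ i = real (snd \<omega> $ i) / 2 ^ j" by (simp add: corner_def e)
      have "\<bar>x $ i - p $ i\<bar> \<le> U / 2 ^ j"
        using component_le_norm_cart[of "x - p" i] w(3) by simp
      moreover have "corner \<omega> $ i \<le> x $ i" "x $ i \<le> corner \<omega> $ i + edge \<omega>"
        using w(2) by (auto simp: mem_cell_set)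
      ultimately have "\<bar>corner \<omega> $ i - p $ i\<bar> \<le> (U + 1) / 2 ^ j"
        unfolding e by (simp add: add_divide_distrib abs_le_iff)
      then have "2 ^ j * \<bar>corner \<omega> $ i - p $ i\<bar> \<le> U + 1"
        by (simp add: field_simps)
      moreover have "2 ^ j * \<bar>corner \<omega> $ i - p $ i\<bar> = \<bar>2 ^ j * (corner \<omega> $ i - p $ i)\<bar>"
        by (simp add: abs_mult)
      ultimately show ?thesis by (simp add: A_def c right_diff_distrib)
    qed
    then have "(\<lambda>i. snd \<omega> $ i) \<in> PiE UNIV A" by auto
    then show "\<omega> \<in> (\<lambda>n. (j, vec_lambda n)) ` PiE UNIV A"
      by (rule image_eqI[rotated]) (simp add: w(1)[symmetric])
  qed
  show "finite N" using sub fP finite_surj by blast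
  have "card N \<le> card (PiE UNIV A)" using sub fP surj_card_le by blast
  also have "\<dots> = (\<Prod>i\<in>UNIV. card (A i))" by (simp add: card_PiE)
  also have "\<dots> \<le> (\<Prod>i\<in>(UNIV :: 'd set). nat \<lfloor>2 * (U + 1)\<rfloor> + 1)"
    by (intro prod_mono) (use A in auto)
  finally show "card N \<le> (nat \<lfloor>2 * (U + 1)\<rfloor> + 1) ^ CARD('d)" by simp
qed

lemma finite_coarse_cells: "finite {\<omega> :: ('d::finite) cell. dyadic_cell \<omega> \<and> fst \<omega> < j0}"
proof (rule finite_subset)
  show "{\<omega> :: 'd cell. dyadic_cell \<omega> \<and> fst \<omega> < j0} \<subseteq>
      {..<j0} \<times> vec_lambda ` (PiE UNIV (\<lambda>_. {..<2 ^ j0}))"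
  proof
    fix \<omega> :: "'d cell" assume w: "\<omega> \<in> {\<omega>. dyadic_cell \<omega> \<and> fst \<omega> < j0}"
    have "snd \<omega> $ i < 2 ^ j0" for i
    proof -
      have "snd \<omega> $ i < 2 ^ fst \<omega>" using w by (auto simp: dyadic_cell_def split: prod.splits)
      also have "\<dots> \<le> (2::nat) ^ j0" using w by (intro power_increasing) auto
      finally show ?thesis .
    qed
    then have "(\<lambda>i. snd \<omega> $ i) \<in> PiE UNIV (\<lambda>_. {..<2 ^ j0})" by auto
    then have "snd \<omega> \<in> vec_lambda ` (PiE UNIV (\<lambda>_. {..<2 ^ j0}))" by (rule image_eqI[rotated]) simp
    then show "\<omega> \<in> {..<j0} \<times> vec_lambda ` (PiE UNIV (\<lambda>_. {..<2 ^ j0}))"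
      using w by (cases \<omega>) auto
  qed
  show "finite ({..<j0} \<times> vec_lambda ` (PiE (UNIV :: 'd set) (\<lambda>_. {..<2 ^ j0 :: nat})))"
    by (intro finite_cartesian_product finite_imageI finite_PiE) auto
qed

text \<open>Refined cells are either coarse or near a point of \<open>P\<close>, and of level at most \<open>J\<close> as long as the
  stopping criterion is not met. Each step contributes at least one of them.\<close>

lemma card_refined_cells_le:
  fixes \<Omega> :: "nat \<Rightarrow> ('d::finite) cell set" and P :: "(real ^ 'd) set"
  assumes init: "cell_partition (\<Omega> 0)" and sub: "\<And>k. C k \<subseteq> \<Omega> k"
    and step: "\<And>k. \<Omega> (Suc k) = refine (\<Omega> k) (C k)"
    and P: "finite P"
    and near: "\<And>k \<omega>. \<omega> \<in> largest_cells (C k) \<Longrightarrow> j0 \<le> fst \<omega> \<Longrightarrow>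
      \<exists>p\<in>P. \<exists>x\<in>cell_set \<omega>. norm (x - p) \<le> U / 2 ^ fst \<omega>"
    and run: "\<And>i. i < k \<Longrightarrow> \<not> stops C J i"
  shows "card (\<Union>i<k. largest_cells (C i)) \<le> card {\<omega> :: 'd cell. dyadic_cell \<omega> \<and> fst \<omega> < j0} +
      (nat \<lfloor>2 * (U + 1)\<rfloor> + 1) ^ CARD('d) * card P * (J + 1)"
    and "k \<le> card (\<Union>i<k. largest_cells (C i))"
proof -
  let ?R = "\<Union>i<k. largest_cells (C i)"
  define M where "M = (nat \<lfloor>2 * (U + 1)\<rfloor> + 1) ^ CARD('d)"
  define N where "N j p = {\<omega> :: 'd cell. fst \<omega> = j \<and> (\<exists>x\<in>cell_set \<omega>. norm (x - p) \<le> U / 2 ^ j)}" for j p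
  have N: "finite (N j p)" "card (N j p) \<le> M" for j p
    unfolding N_def M_def by (rule card_cells_near_point)+
  have coarse: "\<exists>\<omega>\<in>C i. fst \<omega> \<le> J" if i: "i < k" for i
  proof -
    obtain \<omega> where "\<omega> \<in> C i" "\<not> edge \<omega> < 1 / 2 ^ J" using run[OF i] by (auto simp: stops_def)
    moreover then have "(2::real) ^ fst \<omega> \<le> 2 ^ J" by (simp add: edge_def field_simps)
    ultimately show ?thesis by auto
  qed
  have R: "?R \<subseteq> {\<omega> :: 'd cell. dyadic_cell \<omega> \<and> fst \<omega> < j0} \<union> (\<Union>j\<in>{..J}. \<Union>p\<in>P. N j p)"
  proof
    fix \<omega> assume "\<omega> \<in> ?R"
    then obtain i where i: "i < k" "\<omega> \<in> largest_cells (C i)" by blast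
    then have "\<omega> \<in> C i" "\<And>\<omega>'. \<omega>' \<in> C i \<Longrightarrow> fst \<omega> \<le> fst \<omega>'" by (auto simp: largest_cells_eq)
    then have J: "fst \<omega> \<le> J" using coarse[OF i(1)] order_trans by blast
    have dy: "dyadic_cell \<omega>"
      using nonoverlapping_iterates[of \<Omega> C, OF init sub step, of i] sub[of i] \<open>\<omega> \<in> C i\<close>
      by (auto simp: nonoverlapping_def)
    show "\<omega> \<in> {\<omega> :: 'd cell. dyadic_cell \<omega> \<and> fst \<omega> < j0} \<union> (\<Union>j\<in>{..J}. \<Union>p\<in>P. N j p)"
    proof (cases "fst \<omega> < j0")
      case False
      then obtain p where "p \<in> P" "\<omega> \<in> N (fst \<omega>) p"
        using near[OF i(2)] unfolding N_def by fastforce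
      then show ?thesis using J by blast
    qed (use dy in blast)
  qed
  have fin: "finite (\<Union>j\<in>{..J}. \<Union>p\<in>P. N j p)" by (intro finite_UN_I P N finite_atMost)
  have "card ?R \<le> card ({\<omega> :: 'd cell. dyadic_cell \<omega> \<and> fst \<omega> < j0} \<union> (\<Union>j\<in>{..J}. \<Union>p\<in>P. N j p))"
    by (rule card_mono[OF _ R]) (rule finite_UnI[OF finite_coarse_cells fin])
  also have "\<dots> \<le> card {\<omega> :: 'd cell. dyadic_cell \<omega> \<and> fst \<omega> < j0} + card (\<Union>j\<in>{..J}. \<Union>p\<in>P. N j p)"
    by (rule card_Un_le)
  also have "card (\<Union>j\<in>{..J}. \<Union>p\<in>P. N j p) \<le> (\<Sum>j\<in>{..J}. \<Sum>p\<in>P. card (N j p))"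
    by (rule order_trans[OF card_UN_le[OF finite_atMost]]) (rule sum_mono, rule card_UN_le[OF P])
  also have "\<dots> \<le> (\<Sum>j\<in>{..J}. \<Sum>p\<in>P. M)" by (intro sum_mono N)
  also have "\<dots> = M * card P * (J + 1)" by simp
  finally show "card ?R \<le> card {\<omega> :: 'd cell. dyadic_cell \<omega> \<and> fst \<omega> < j0} +
      (nat \<lfloor>2 * (U + 1)\<rfloor> + 1) ^ CARD('d) * card P * (J + 1)"
    unfolding M_def by linarith
  have finR: "finite ?R" 
    by (rule finite_subset[OF R finite_UnI[OF finite_coarse_cells fin]])
  have "\<exists>\<omega>. \<omega> \<in> largest_cells (C i)" if "i < k" for i
    using coarse[OF that] by (intro largest_cells_nonempty) auto
  then have "\<forall>i\<in>{..<k}. \<exists>\<omega>. \<omega> \<in> largest_cells (C i)" by blast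
  from bchoice[OF this] obtain w where w: "\<And>i. i < k \<Longrightarrow> w i \<in> largest_cells (C i)" by blast
  have disj: "largest_cells (C i) \<inter> largest_cells (C i') = {}" if "i \<noteq> i'" for i i'
    using refined_cells_disjoint[of \<Omega> C, OF init sub step] that
    unfolding disjoint_family_on_def by blast
  have "inj_on w {..<k}"
  proof (rule inj_onI)
    fix i i' assume "i \<in> {..<k}" "i' \<in> {..<k}" "w i = w i'"
    then show "i = i'" using w[of i] w[of i'] disj[of i i'] by auto
  qed
  moreover have "w ` {..<k} \<subseteq> ?R" using w by blast
  ultimately have "card {..<k} \<le> card ?R" using finR card_inj_on_le by blast
  then show "k \<le> card ?R" by simp
qed

section \<open>Certificates at small scales\<close>

lemma A_adj_scaleR: "A_adj a (c *\<^sub>R q) x = c * A_adj a q x"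
  by (simp add: A_adj_inner)

lemma A_adj_diff: "A_adj a (p - q) x = A_adj a p x - A_adj a q x"
  by (simp add: A_adj_inner inner_diff_left)

lemma grad_A_adj_scaleR:
  assumes "\<And>m. b m differentiable_on Cube" "x \<in> Cube"
  shows "grad Cube (A_adj b (c *\<^sub>R q)) x = c *\<^sub>R grad Cube (A_adj b q) x"
  using assms by (simp add: grad_def vec_eq_iff partial_A_adj A_adj_def sum_distrib_left mult.assoc)

text \<open>A nonzero value cannot be attained on the boundary, where all \<open>a m\<close> vanish.\<close>

lemma grad_A_adj_at_extremum:
  fixes a :: "'m::finite \<Rightarrow> real ^ 'd::finite \<Rightarrow> real"
  assumes d: "\<And>m. a m differentiable_on Cube" and bd: "\<And>m x. x \<in> frontier Cube \<Longrightarrow> a m x = 0"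
    and x: "x \<in> Cube" "A_adj a q x \<noteq> 0"
    and max: "\<And>y. y \<in> Cube \<Longrightarrow> \<bar>A_adj a q y\<bar> \<le> \<bar>A_adj a q x\<bar>"
  shows "grad Cube (A_adj a q) x = 0"
proof -
  define \<sigma> where "\<sigma> = sgn (A_adj a q x)"
  have zero: "\<And>y. y \<in> frontier Cube \<Longrightarrow> A_adj a q y = 0" using bd by (simp add: A_adj_def)
  then have xf: "x \<notin> frontier Cube" using x(2) by blast
  have \<sigma>: "\<bar>\<sigma>\<bar> = 1" "\<sigma> * A_adj a q x = \<bar>A_adj a q x\<bar>"
    using x(2) by (auto simp: \<sigma>_def sgn_if)
  have "grad Cube (A_adj a (\<sigma> *\<^sub>R q)) x = 0"
  proof (rule grad_eq_0_at_interior_maximum)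
    show "A_adj a (\<sigma> *\<^sub>R q) differentiable_on Cube" by (rule A_adj_differentiable_on[of a, OF d])
    fix y :: "real ^ 'd" assume y: "y \<in> Cube"
    have "\<sigma> * A_adj a q y \<le> \<bar>\<sigma> * A_adj a q y\<bar>" by simp
    also have "\<dots> = \<bar>A_adj a q y\<bar>" by (simp add: abs_mult \<sigma>(1))
    finally show "A_adj a (\<sigma> *\<^sub>R q) y \<le> A_adj a (\<sigma> *\<^sub>R q) x"
      using max[OF y] \<sigma>(2) by (simp add: A_adj_scaleR)
  qed (use x xf in auto)
  then have "\<sigma> *\<^sub>R grad Cube (A_adj a q) x = 0"
    by (simp add: grad_A_adj_scaleR[of a, OF d x(1)])
  then show ?thesis using \<sigma>(1) by auto
qed

text \<open>At a global maximizer \<open>x0\<close> with value above 1 the gradient vanishes, so the value at the corner of the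
  candidate cell around \<open>x0\<close>, whose modulus is at most 1, falls below the maximum only to second order.\<close>

lemma dual_violation_bound:
  fixes a :: "'m::finite \<Rightarrow> real ^ 'd::finite \<Rightarrow> real"
  assumes C2: "\<And>m. C2_on Cube (a m)" and bd: "\<And>m x. x \<in> frontier Cube \<Longrightarrow> a m x = 0"
    and B: "B \<ge> 0" "\<And>q x h. x \<in> Cube \<Longrightarrow>
      \<bar>h \<bullet> (hessian Cube (A_adj a q) x *v h)\<bar> \<le> B * norm q * (norm h)\<^sup>2"
    and q: "norm q \<le> Q"
    and cover: "big_local_maximizers (A_adj a q) \<subseteq> (\<Union>\<omega>\<in>C. cell_set \<omega>)"
    and C: "\<And>\<omega>. \<omega> \<in> C \<Longrightarrow> dyadic_cell \<omega>" "\<And>\<omega>. \<omega> \<in> C \<Longrightarrow> edge \<omega> \<le> e"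
      "\<And>\<omega>. \<omega> \<in> C \<Longrightarrow> \<bar>A_adj a q (corner \<omega>)\<bar> \<le> 1"
    and x: "x \<in> Cube"
  shows "\<bar>A_adj a q x\<bar> \<le> 1 + B * Q * (real CARD('d))\<^sup>2 / 2 * e\<^sup>2"
proof -
  have d: "a m differentiable_on Cube" for m using C2[of m] by (simp add: C2_on_def)
  have Q: "Q \<ge> 0" using q norm_ge_zero order_trans by blast
  have "continuous_on Cube (\<lambda>y. \<bar>A_adj a q y\<bar>)"
    by (intro continuous_on_rabs continuous_on_A_adj differentiable_imp_continuous_on d)
  then obtain x0 where x0: "x0 \<in> Cube" "\<And>y. y \<in> Cube \<Longrightarrow> \<bar>A_adj a q y\<bar> \<le> \<bar>A_adj a q x0\<bar>"
    using continuous_attains_sup[OF compact_Cube] x by blast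
  have "\<bar>A_adj a q x0\<bar> \<le> 1 + B * Q * (real CARD('d))\<^sup>2 / 2 * e\<^sup>2"
  proof (cases "\<bar>A_adj a q x0\<bar> \<le> 1")
    case True
    moreover have "0 \<le> B * Q * (real CARD('d))\<^sup>2 / 2 * e\<^sup>2" using B(1) Q by simp
    ultimately show ?thesis by linarith
  next
    case False
    have "\<forall>\<^sub>F y in at x0 within Cube. \<bar>A_adj a q y\<bar> \<le> \<bar>A_adj a q x0\<bar>"
      unfolding eventually_at_filter using x0(2) by (auto intro: always_eventually)
    then have "x0 \<in> big_local_maximizers (A_adj a q)"
      using x0(1) False by (simp add: big_local_maximizers_def)
    then obtain \<omega> where \<omega>: "\<omega> \<in> C" "x0 \<in> cell_set \<omega>" using cover by blast
    have cs: "corner \<omega> \<in> cell_set \<omega>" using corner_in_cell_vert cell_vert_subset by blast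
    have cC: "corner \<omega> \<in> Cube" using cs cell_set_subset_Cube[OF C(1)[OF \<omega>(1)]] by blast
    define h where "h = corner \<omega> - x0"
    define \<sigma> where "\<sigma> = - sgn (A_adj a q x0)"
    have \<sigma>: "\<bar>\<sigma>\<bar> = 1" "\<sigma> * A_adj a q x0 = - \<bar>A_adj a q x0\<bar>"
      using False by (auto simp: \<sigma>_def sgn_if)
    have "norm h \<le> real CARD('d) * edge \<omega>"
      unfolding h_def by (rule norm_le_of_mem_cell_set[OF cs \<omega>(2)])
    also have "\<dots> \<le> real CARD('d) * e" by (intro mult_left_mono C(2)[OF \<omega>(1)]) simp
    finally have h: "(norm h)\<^sup>2 \<le> (real CARD('d) * e)\<^sup>2" by (intro power_mono) auto
    have "A_adj a (\<sigma> *\<^sub>R q) (x0 + h) \<le> A_adj a (\<sigma> *\<^sub>R q) x0 + h \<bullet> grad Cube (A_adj a (\<sigma> *\<^sub>R q)) x0 +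
        B * Q * (real CARD('d) * e)\<^sup>2 / 2"
    proof (rule C2_upper_bound)
      show "C2_on Cube (A_adj a (\<sigma> *\<^sub>R q))" by (rule C2_on_A_adj[of a, OF C2])
      show xh: "x0 \<in> Cube" "x0 + h \<in> Cube" using x0 cC by (auto simp: h_def)
      fix t :: real assume t: "0 \<le> t" "t \<le> 1"
      have "h \<bullet> (hessian Cube (A_adj a (\<sigma> *\<^sub>R q)) (x0 + t *\<^sub>R h) *v h) \<le> B * norm (\<sigma> *\<^sub>R q) * (norm h)\<^sup>2"
        using B(2)[OF segment_in_Cube[OF xh t], of h "\<sigma> *\<^sub>R q"] by linarith
      also have "\<dots> \<le> B * Q * (real CARD('d) * e)\<^sup>2"
        by (intro mult_mono h) (use B(1) q Q \<sigma>(1) in auto)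
      finally show "h \<bullet> (hessian Cube (A_adj a (\<sigma> *\<^sub>R q)) (x0 + t *\<^sub>R h) *v h) \<le> B * Q * (real CARD('d) * e)\<^sup>2" .
    qed
    moreover have "grad Cube (A_adj a q) x0 = 0"
      using False by (intro grad_A_adj_at_extremum[of a, OF d bd x0(1) _ x0(2)]) auto
    moreover have "x0 + h = corner \<omega>" by (simp add: h_def)
    ultimately have "\<sigma> * A_adj a q (corner \<omega>) \<le> - \<bar>A_adj a q x0\<bar> + B * Q * (real CARD('d) * e)\<^sup>2 / 2"
      using \<sigma>(2) by (simp add: A_adj_scaleR grad_A_adj_scaleR[of a, OF d x0(1)])
    moreover have "\<bar>\<sigma> * A_adj a q (corner \<omega>)\<bar> \<le> 1"
      using C(3)[OF \<omega>(1)] \<sigma>(1) by (simp add: abs_mult)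
    moreover have "B * Q * (real CARD('d) * e)\<^sup>2 / 2 = B * Q * (real CARD('d))\<^sup>2 / 2 * e\<^sup>2"
      by (simp add: power_mult_distrib)
    ultimately show ?thesis by linarith
  qed
  then show ?thesis using x0(2)[OF x] by linarith
qed

text \<open>The structure of the limiting certificate, restated around the points where its modulus is exactly 1.
  This is a subset of the \<open>xs s\<close>: a point with zero weight may fail to be a peak, and the modulus of
  the certificate then stays below 1 near it. The multiplier \<open>A_adj a q0 p\<close> is the sign \<open>\<pm>1\<close> at the peak, and
  \<open>\<delta>\<close> comes from compactness of the cube without the balls around the peaks.\<close>

lemma certificate_peaks:
  fixes a :: "'m::finite \<Rightarrow> real ^ 'd::finite \<Rightarrow> real"
  assumes C2: "\<And>m. C2_on Cube (a m)"
    and source: "nondegenerate_source_condition a f S \<alpha> xs q0"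
    and le1: "\<forall>x\<in>Cube. \<bar>A_adj a q0 x\<bar> \<le> 1"
  defines "P \<equiv> {y \<in> Cube. \<bar>A_adj a q0 y\<bar> = 1}"
  shows "\<exists>\<gamma>>0. \<exists>r>0. \<exists>\<delta>>0.
    (\<forall>p\<in>P. \<forall>y\<in>Cube. norm (y - p) < r \<longrightarrow> \<bar>A_adj a q0 y - A_adj a q0 p\<bar> < 1 / 2 \<and>
      (\<forall>h. h \<bullet> (hessian Cube (A_adj a (A_adj a q0 p *\<^sub>R q0)) y *v h) \<le> - \<gamma> * (norm h)\<^sup>2)) \<and>
    (\<forall>x\<in>Cube. 1 - \<delta> < \<bar>A_adj a q0 x\<bar> \<longrightarrow> (\<exists>p\<in>P. norm (x - p) < r))"
proof -
  define X where "X = xs ` {1..S}"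
  have PX: "P \<subseteq> X" using source unfolding nondegenerate_source_condition_def P_def X_def by blast
  obtain \<gamma> R where \<gamma>: "\<gamma> > 0" "R > 0" and hess: "\<And>y. y \<in> Cube \<Longrightarrow> dist_to y X \<le> ereal R \<Longrightarrow>
      loewner_le (sgn (A_adj a q0 y) *\<^sub>R hessian Cube (A_adj a q0) y) (- \<gamma> *\<^sub>R mat 1)"
    using source unfolding nondegenerate_source_condition_def X_def by blast
  have cont: "continuous_on Cube (A_adj a q0)"
    using C2_on_A_adj[of a, OF C2] by (auto simp: C2_on_def intro: differentiable_imp_continuous_on)
  then have "uniformly_continuous_on Cube (A_adj a q0)"
    by (rule compact_uniformly_continuous) (rule compact_Cube)
  then obtain \<eta> where \<eta>: "\<eta> > 0"
    "\<And>x y. x \<in> Cube \<Longrightarrow> y \<in> Cube \<Longrightarrow> dist y x < \<eta> \<Longrightarrow> dist (A_adj a q0 y) (A_adj a q0 x) < 1 / 2"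
    unfolding uniformly_continuous_on_def by (meson half_gt_zero zero_less_one)
  define r where "r = min R \<eta>"
  have r: "r > 0" using \<gamma> \<eta> by (simp add: r_def)
  have peak: "\<bar>A_adj a q0 y - A_adj a q0 p\<bar> < 1 / 2 \<and>
      (\<forall>h. h \<bullet> (hessian Cube (A_adj a (A_adj a q0 p *\<^sub>R q0)) y *v h) \<le> - \<gamma> * (norm h)\<^sup>2)"
    if p: "p \<in> P" and y: "y \<in> Cube" and near: "norm (y - p) < r" for p y
  proof (intro conjI allI)
    show d: "\<bar>A_adj a q0 y - A_adj a q0 p\<bar> < 1 / 2"
      using \<eta>(2)[of p y] p y near by (auto simp: P_def r_def dist_norm)
    have "\<bar>A_adj a q0 p\<bar> = 1" using p by (simp add: P_def)
    then have sg: "sgn (A_adj a q0 y) = A_adj a q0 p" using d by (auto simp: sgn_if abs_if split: if_splits)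
    have "dist_to y X \<le> ereal (norm (y - p))"
      unfolding dist_to_def using p PX by (intro INF_lower) blast
    also have "\<dots> \<le> ereal R" using near by (simp add: r_def)
    finally have lw: "loewner_le (A_adj a q0 p *\<^sub>R hessian Cube (A_adj a q0) y) (- \<gamma> *\<^sub>R mat 1)"
      using hess[OF y] sg by simp
    fix h
    have "h \<bullet> (hessian Cube (A_adj a (A_adj a q0 p *\<^sub>R q0)) y *v h)
        \<le> h \<bullet> ((- \<gamma> *\<^sub>R mat 1) *v h)"
      using lw unfolding loewner_le_def hessian_A_adj_scaleR[of a, OF C2 y] by blast
    also have "\<dots> = - \<gamma> * (norm h)\<^sup>2"
      unfolding scaleR_matrix_vector_assoc[symmetric] matrix_vector_mul_lid
      by (simp add: power2_norm_eq_inner)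
    finally show "h \<bullet> (hessian Cube (A_adj a (A_adj a q0 p *\<^sub>R q0)) y *v h) \<le> - \<gamma> * (norm h)\<^sup>2" .
  qed
  define K where "K = Cube - (\<Union>p\<in>P. ball p r)"
  have K: "compact K" unfolding K_def by (intro compact_diff compact_Cube open_UN ballI open_ball)
  have "\<exists>\<delta>>0. \<forall>x\<in>K. \<bar>A_adj a q0 x\<bar> \<le> 1 - \<delta>"
  proof (cases "K = {}")
    case False
    have "continuous_on K (\<lambda>y. \<bar>A_adj a q0 y\<bar>)"
      by (intro continuous_on_rabs continuous_on_subset[OF cont]) (auto simp: K_def)
    then obtain x1 where x1: "x1 \<in> K" "\<And>x. x \<in> K \<Longrightarrow> \<bar>A_adj a q0 x\<bar> \<le> \<bar>A_adj a q0 x1\<bar>"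
      using continuous_attains_sup[OF K False] by blast
    have "x1 \<in> Cube" "x1 \<notin> P" using x1(1) r by (auto simp: K_def)
    then have "\<bar>A_adj a q0 x1\<bar> < 1" using le1 by (force simp: P_def)
    then show ?thesis using x1(2) by (intro exI[of _ "1 - \<bar>A_adj a q0 x1\<bar>"]) auto
  qed (auto intro: exI[of _ 1])
  then obtain \<delta> where \<delta>: "\<delta> > 0" "\<And>x. x \<in> K \<Longrightarrow> \<bar>A_adj a q0 x\<bar> \<le> 1 - \<delta>" by blast
  have "\<exists>p\<in>P. norm (x - p) < r" if x: "x \<in> Cube" "1 - \<delta> < \<bar>A_adj a q0 x\<bar>" for x
  proof -
    have "x \<notin> K" using \<delta>(2)[of x] x(2) by linarith
    then obtain p where "p \<in> P" "x \<in> ball p r" using x(1) by (auto simp: K_def)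
    then show ?thesis by (auto simp: dist_norm norm_minus_commute)
  qed
  then show ?thesis using \<gamma>(1) r \<delta>(1) peak by blast
qed

text \<open>In units of \<open>e\<close>, the inequality \<open>\<gamma> / 4 * u^2 \<le> c0 + c1 * u\<close> bounds \<open>u\<close>, because for \<open>u \<ge> 1\<close> the
  right-hand side is at most \<open>(c0 + c1) * u\<close>.\<close>

lemma quadratic_root_bound:
  fixes u :: real
  assumes "\<gamma> > 0" "c0 \<ge> 0" "c1 \<ge> 0" "\<gamma> / 4 * u\<^sup>2 \<le> c0 * e\<^sup>2 + c1 * e * u" "u \<ge> 0" "e > 0"
  shows "u \<le> (1 + 4 * (c0 + c1) / \<gamma>) * e"
proof (rule ccontr)
  assume neg: "\<not> ?thesis"
  have k: "4 * (c0 + c1) / \<gamma> \<ge> 0" using assms by simp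
  then have "0 \<le> 4 * (c0 + c1) / \<gamma> * e" using assms(6) by (intro mult_nonneg_nonneg) auto
  then have "e \<le> (1 + 4 * (c0 + c1) / \<gamma>) * e" unfolding distrib_right by linarith
  then have eu: "e < u" using neg by linarith
  have "c0 * e\<^sup>2 \<le> c0 * (e * u)"
    using eu assms unfolding power2_eq_square by (intro mult_left_mono) auto
  then have "\<gamma> / 4 * u\<^sup>2 \<le> ((c0 + c1) * e) * u" using assms(4) by (simp add: algebra_simps)
  then have "\<gamma> / 4 * u \<le> (c0 + c1) * e"
    using eu assms(6) by (simp add: power2_eq_square)
  then have "u \<le> 4 * (c0 + c1) / \<gamma> * e" using assms(1) by (simp add: field_simps)
  then show False using neg assms(6) by (simp add: algebra_simps)
qed

text \<open>Taylor's formula at the peak \<open>p\<close>. The perturbation \<open>q - q0\<close> adds a gradient of order \<open>e\<close> and costs at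
  most half of the concavity, so that \<open>\<gamma> / 4 * norm (x - p)^2\<close> is bounded by terms of order \<open>e^2\<close> and
  \<open>e * norm (x - p)\<close>.\<close>

lemma near_peak:
  fixes a :: "'m::finite \<Rightarrow> real ^ 'd::finite \<Rightarrow> real"
  assumes C2: "\<And>m. C2_on Cube (a m)"
    and B: "B \<ge> 0" "\<And>q x h. x \<in> Cube \<Longrightarrow> \<bar>h \<bullet> grad Cube (A_adj a q) x\<bar> \<le> B * norm q * norm h"
      "\<And>q x h. x \<in> Cube \<Longrightarrow>
      \<bar>h \<bullet> (hessian Cube (A_adj a q) x *v h)\<bar> \<le> B * norm q * (norm h)\<^sup>2"
    and p: "p \<in> Cube" "grad Cube (A_adj a q0) p = 0" and \<sigma>: "\<bar>\<sigma>\<bar> = 1"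
    and concave: "\<And>y h. y \<in> Cube \<Longrightarrow> norm (y - p) < r \<Longrightarrow>
      h \<bullet> (hessian Cube (A_adj a (\<sigma> *\<^sub>R q0)) y *v h) \<le> - \<gamma> * (norm h)\<^sup>2"
    and x: "x \<in> Cube" "norm (x - p) < r"
    and q: "norm (q - q0) \<le> C1 * e" and small: "B * (C1 * e) \<le> \<gamma> / 2"
    and at_p: "\<bar>A_adj a q p\<bar> \<le> 1 + C2 * e\<^sup>2" and at_x: "1 - \<kappa> * e\<^sup>2 \<le> \<sigma> * A_adj a q x"
    and nn: "\<gamma> > 0" "e > 0" "C1 \<ge> 0" "C2 \<ge> 0" "\<kappa> \<ge> 0"
  shows "norm (x - p) \<le> (1 + 4 * (\<kappa> + C2 + B * C1) / \<gamma>) * e"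
proof -
  have d: "a m differentiable_on Cube" for m using assms(1)[of m] by (simp add: C2_on_def)
  define h where "h = x - p"
  have split: "\<sigma> *\<^sub>R q = \<sigma> *\<^sub>R q0 + \<sigma> *\<^sub>R (q - q0)" by (simp add: algebra_simps)
  have dq: "B * norm (\<sigma> *\<^sub>R (q - q0)) \<le> B * (C1 * e)"
    using q \<sigma> B(1) by (intro mult_left_mono) auto
  have "A_adj a (\<sigma> *\<^sub>R q) (p + h) \<le> A_adj a (\<sigma> *\<^sub>R q) p + h \<bullet> grad Cube (A_adj a (\<sigma> *\<^sub>R q)) p +
      (- \<gamma> / 2 * (norm h)\<^sup>2) / 2"
  proof (rule C2_upper_bound)
    show "C2_on Cube (A_adj a (\<sigma> *\<^sub>R q))" by (rule C2_on_A_adj[of a, OF assms(1)])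
    show xh: "p \<in> Cube" "p + h \<in> Cube" using p x by (auto simp: h_def)
    fix t :: real assume t: "0 \<le> t" "t \<le> 1"
    let ?z = "p + t *\<^sub>R h"
    have z: "?z \<in> Cube" by (rule segment_in_Cube[OF xh t])
    have "norm (?z - p) \<le> norm h" using t by (simp add: mult_left_le_one_le)
    then have "norm (?z - p) < r" using x(2) by (simp add: h_def)
    then have 1: "h \<bullet> (hessian Cube (A_adj a (\<sigma> *\<^sub>R q0)) ?z *v h) \<le> - \<gamma> * (norm h)\<^sup>2"
      by (rule concave[OF z])
    have "h \<bullet> (hessian Cube (A_adj a (\<sigma> *\<^sub>R (q - q0))) ?z *v h) \<le> B * norm (\<sigma> *\<^sub>R (q - q0)) * (norm h)\<^sup>2"
      using B(3)[OF z, of h "\<sigma> *\<^sub>R (q - q0)"] by linarith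
    also have "\<dots> \<le> \<gamma> / 2 * (norm h)\<^sup>2" using dq small by (intro mult_right_mono) auto
    finally have 2: "h \<bullet> (hessian Cube (A_adj a (\<sigma> *\<^sub>R (q - q0))) ?z *v h) \<le> \<gamma> / 2 * (norm h)\<^sup>2" .
    show "h \<bullet> (hessian Cube (A_adj a (\<sigma> *\<^sub>R q)) ?z *v h) \<le> - \<gamma> / 2 * (norm h)\<^sup>2"
      unfolding split hessian_A_adj_add[of a, OF assms(1) z] matrix_vector_mult_add_rdistrib inner_add_right
      using 1 2 by linarith
  qed
  moreover have "h \<bullet> grad Cube (A_adj a (\<sigma> *\<^sub>R q)) p \<le> B * (C1 * e) * norm h"
  proof -
    have "h \<bullet> grad Cube (A_adj a (\<sigma> *\<^sub>R q)) p = h \<bullet> grad Cube (A_adj a (\<sigma> *\<^sub>R (q - q0))) p"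
      unfolding split grad_A_adj_add[of a, OF d p(1)]
      by (simp add: grad_A_adj_scaleR[of a, OF d p(1), of \<sigma> q0] p(2))
    also have "\<dots> \<le> B * norm (\<sigma> *\<^sub>R (q - q0)) * norm h"
      using B(2)[OF p(1), of h "\<sigma> *\<^sub>R (q - q0)"] by linarith
    also have "\<dots> \<le> B * (C1 * e) * norm h" using dq by (intro mult_right_mono) auto
    finally show ?thesis .
  qed
  moreover have "\<sigma> * A_adj a q p \<le> 1 + C2 * e\<^sup>2"
  proof -
    have "\<sigma> * A_adj a q p \<le> \<bar>\<sigma> * A_adj a q p\<bar>" by simp
    then show ?thesis using at_p \<sigma> by (simp add: abs_mult)
  qed
  moreover have "p + h = x" by (simp add: h_def)
  ultimately have "1 - \<kappa> * e\<^sup>2 \<le> 1 + C2 * e\<^sup>2 + B * (C1 * e) * norm h + (- \<gamma> / 2 * (norm h)\<^sup>2) / 2"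
    using at_x unfolding A_adj_scaleR by simp
  then have "\<gamma> / 4 * (norm h)\<^sup>2 \<le> (\<kappa> + C2) * e\<^sup>2 + (B * C1) * e * norm h"
    by (simp add: algebra_simps)
  then have "norm h \<le> (1 + 4 * ((\<kappa> + C2) + B * C1) / \<gamma>) * e"
    by (rule quadratic_root_bound[rotated 3]) (use nn B(1) in auto)
  then show ?thesis by (simp add: h_def)
qed

section \<open>Convergence of the algorithm\<close>

lemma sup_norm_cell_attained:
  assumes "continuous_on Cube g" "dyadic_cell \<omega>" "c \<le> sup_norm (cell_set \<omega>) g"
  shows "\<exists>x\<in>cell_set \<omega>. c \<le> \<bar>g x\<bar>"
proof -
  have ne: "cell_set \<omega> \<noteq> {}" using corner_in_cell_vert cell_vert_subset by blast
  have "continuous_on (cell_set \<omega>) (\<lambda>y. \<bar>g y\<bar>)"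
    by (intro continuous_on_rabs continuous_on_subset[OF assms(1)] cell_set_subset_Cube assms)
  then obtain x where x: "x \<in> cell_set \<omega>" "\<And>y. y \<in> cell_set \<omega> \<Longrightarrow> \<bar>g y\<bar> \<le> \<bar>g x\<bar>"
    using continuous_attains_sup[of "cell_set \<omega>"] ne compact_cbox[of "corner \<omega>"] cell_set_cbox[of \<omega>]
    by metis
  have "sup_norm (cell_set \<omega>) g \<le> \<bar>g x\<bar>"
    unfolding sup_norm_def using ne x(2) by (rule cSUP_least)
  then show ?thesis using x(1) assms(3) by force
qed

text \<open>All estimates of the theorem, for one step of the algorithm whose candidates have level at least \<open>j\<close>.
  The constants precede the step in the quantifier order, so they are common to all runs.\<close>

lemma estimates_at_resolution:
  fixes a :: "'m::finite \<Rightarrow> real ^ 'd::finite \<Rightarrow> real"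
  assumes a_C2: "\<And>m. C2_on Cube (a m)"
    and a_boundary: "\<forall>m. \<forall>x\<in>frontier Cube. a m x = 0"
    and f_convex: "convex_on UNIV f"
    and f_grad: "\<And>y. GDERIV f y :> gradf y"
    and f_lipschitz: "L-lipschitz_on UNIV gradf"
    and coercive: "coercive_objective a f"
    and source: "nondegenerate_source_condition a f S \<alpha> xs q0"
    and kappa_pos: "\<kappa> > 0"
  shows "\<exists>j0 K U. \<exists>P \<subseteq> xs ` {1..S}. 0 \<le> K \<and> 0 \<le> U \<and>
    (\<forall>W C \<mu> q j. nonoverlapping W \<longrightarrow> C \<subseteq> W \<longrightarrow>
       primal_solution a f (vert W) \<mu> \<longrightarrow> dual_solution a f (vert W) q \<longrightarrow>
       big_local_maximizers (A_adj a q) \<subseteq> (\<Union>\<omega>\<in>C. cell_set \<omega>) \<longrightarrow>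
       (\<forall>\<omega>\<in>C. 1 - \<kappa> * (edge \<omega>)\<^sup>2 \<le> sup_norm (cell_set \<omega>) (A_adj a q)) \<longrightarrow>
       j0 \<le> j \<longrightarrow> (\<forall>\<omega>\<in>C. j \<le> fst \<omega>) \<longrightarrow>
       norm (q - q0) \<le> K / 2 ^ j \<and>
       objective a f \<mu> - objective a f (dirac_comb S \<alpha> xs) \<le> K / 2 ^ (2 * j) \<and>
       (\<forall>\<omega>\<in>C. \<exists>p\<in>P. \<exists>x\<in>cell_set \<omega>. norm (x - p) \<le> U / 2 ^ j))"
proof -
  have bd: "\<And>m x. x \<in> frontier Cube \<Longrightarrow> a m x = 0" using a_boundary by blast
  have diff: "a m differentiable_on Cube" for m using a_C2[of m] by (simp add: C2_on_def)
  have cont: "continuous_on Cube (a m)" for m by (intro differentiable_imp_continuous_on diff)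
  define X where "X = xs ` {1..S}"
  have X: "finite X" "X \<subseteq> Cube"
    and pstar: "primal_solution a f Cube (dirac_comb S \<alpha> xs)" and dstar: "dual_solution a f Cube q0"
    using source unfolding nondegenerate_source_condition_def X_def by auto
  obtain w where w: "dirac_comb S \<alpha> xs = comb X w" unfolding X_def using dirac_comb_eq_comb by blast
  have ne: "(Cube :: (real ^ 'd) set) \<noteq> {}" using mem_Cube[of 0] by auto
  note star = dual_solution_eq_gradient[OF cont f_convex f_grad X subset_refl ne pstar[unfolded w] dstar]
  have le1: "\<forall>x\<in>Cube. \<bar>A_adj a q0 x\<bar> \<le> 1" using star(3) by blast
  define T where "T = tv_norm (comb X w)"
  have T: "T \<ge> 0" unfolding T_def tv_norm_comb[OF X(1)] by (intro sum_nonneg) auto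
  obtain B where B: "B > 0" "\<And>q x. x \<in> Cube \<Longrightarrow> \<bar>A_adj a q x\<bar> \<le> B * norm q"
    "\<And>q x h. x \<in> Cube \<Longrightarrow> \<bar>h \<bullet> grad Cube (A_adj a q) x\<bar> \<le> B * norm q * norm h"
    "\<And>q x h. x \<in> Cube \<Longrightarrow> \<bar>h \<bullet> (hessian Cube (A_adj a q) x *v h)\<bar> \<le> B * norm q * (norm h)\<^sup>2"
    using A_adj_derivatives_bounded[of a, OF a_C2] by blast
  obtain Q0 where Q0: "\<And>V F w. finite F \<Longrightarrow> F \<subseteq> V \<Longrightarrow> V \<subseteq> Cube \<Longrightarrow> primal_solution a f V (comb F w) \<Longrightarrow>
      norm (gradf (A_op a (comb F w))) \<le> Q0"
    using dual_iterates_bounded[OF cont f_lipschitz coercive] by blast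
  define Q where "Q = max Q0 0"
  define P where "P = {y \<in> Cube. \<bar>A_adj a q0 y\<bar> = 1}"
  have PX: "P \<subseteq> X" using source unfolding nondegenerate_source_condition_def P_def X_def by blast
  obtain \<gamma> r \<delta> where \<gamma>: "\<gamma> > 0" "r > 0" "\<delta> > 0"
    and peaks: "\<forall>p\<in>P. \<forall>y\<in>Cube. norm (y - p) < r \<longrightarrow> \<bar>A_adj a q0 y - A_adj a q0 p\<bar> < 1 / 2 \<and>
      (\<forall>h. h \<bullet> (hessian Cube (A_adj a (A_adj a q0 p *\<^sub>R q0)) y *v h) \<le> - \<gamma> * (norm h)\<^sup>2)"
    and off: "\<forall>x\<in>Cube. 1 - \<delta> < \<bar>A_adj a q0 x\<bar> \<longrightarrow> (\<exists>p\<in>P. norm (x - p) < r)"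
    using certificate_peaks[of a, OF a_C2 source le1, folded P_def] by (elim exE conjE) (rule that)
  have peak: "\<bar>A_adj a q0 y - A_adj a q0 p\<bar> < 1 / 2"
    "h \<bullet> (hessian Cube (A_adj a (A_adj a q0 p *\<^sub>R q0)) y *v h) \<le> - \<gamma> * (norm h)\<^sup>2"
    if "p \<in> P" "y \<in> Cube" "norm (y - p) < r" for p y h
    using peaks that by blast+
  \<comment> \<open>the case \<open>L = 0\<close> is covered by enlarging the Lipschitz constant\<close>
  define L' where "L' = max L 1"
  have L': "L' > 0" "L'-lipschitz_on UNIV gradf"
    unfolding L'_def by (simp, rule lipschitz_on_mono[OF f_lipschitz]) auto
  define C2 where "C2 = B * Q * (real CARD('d))\<^sup>2 / 2"
  have C2: "C2 \<ge> 0" using B(1) by (simp add: C2_def Q_def)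
  define C1 where "C1 = sqrt (2 * L' * (C2 * T))"
  have C1: "C1 \<ge> 0" using C2 T L'(1) by (simp add: C1_def)
  define K where "K = C1 + C2 * T"
  define U where "U = 1 + 4 * (\<kappa> + C2 + B * C1) / \<gamma>"
  define D where "D = \<kappa> + B * C1 + 1"
  have D: "D > 0" "\<kappa> \<le> D" "B * C1 \<le> D" using kappa_pos mult_nonneg_nonneg[OF less_imp_le[OF B(1)] C1] by (auto simp: D_def)
  \<comment> \<open>below this scale the perturbation of order \<open>D * e\<close> affects neither the concavity, nor the gap \<open>\<delta>\<close>, nor the sign\<close>
  define e0 where "e0 = min 1 (min (\<delta> / (2 * D)) (min (\<gamma> / (2 * D)) (1 / (4 * D))))"
  have e0: "e0 > 0" using D \<gamma> by (simp add: e0_def)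
  obtain j0 where j0: "(1 / 2 :: real) ^ j0 < e0" using real_arch_pow_inv[OF e0, of "1 / 2"] by auto
  have K: "0 \<le> K" using C1 C2 T by (simp add: K_def)
  have "0 \<le> B * C1" using B(1) C1 by simp
  then have U: "0 \<le> U" using C2 \<gamma>(1) kappa_pos by (simp add: U_def)
  show ?thesis
  proof (rule exI[of _ j0], rule exI[of _ K], rule exI[of _ U], rule exI[of _ P],
      rule conjI[OF PX[unfolded X_def]], rule conjI[OF K], rule conjI[OF U], intro allI impI)
    fix W C :: "'d cell set" and \<mu> :: "'d smeasure" and q :: "real ^ 'm" and j :: nat
    assume W: "nonoverlapping W" and CW: "C \<subseteq> W"
      and primal: "primal_solution a f (vert W) \<mu>" and dual: "dual_solution a f (vert W) q"
      and cover: "big_local_maximizers (A_adj a q) \<subseteq> (\<Union>\<omega>\<in>C. cell_set \<omega>)"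
      and cand: "\<forall>\<omega>\<in>C. 1 - \<kappa> * (edge \<omega>)\<^sup>2 \<le> sup_norm (cell_set \<omega>) (A_adj a q)"
      and j: "j0 \<le> j" and level: "\<forall>\<omega>\<in>C. j \<le> fst \<omega>"
    define e :: real where "e = 1 / 2 ^ j"
    have e: "e > 0" by (simp add: e_def)
    have "e \<le> (1 / 2) ^ j0" unfolding e_def power_one_over[symmetric] using j by (intro power_decreasing) auto
    then have ee0: "e < e0" using j0 by linarith
    have De: "D * e \<le> \<delta> / 2" "D * e \<le> \<gamma> / 2" "D * e \<le> 1 / 4"
      using ee0 D(1) by (auto simp: e0_def field_simps)
    have e1: "e\<^sup>2 \<le> e" using ee0 e by (simp add: e0_def power2_eq_square mult_le_cancel_right1)
    have fW: "finite W" "W \<noteq> {}" and dy: "\<And>\<omega>. \<omega> \<in> W \<Longrightarrow> dyadic_cell \<omega>"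
      using W by (auto simp: nonoverlapping_def)
    have vC: "vert W \<subseteq> Cube"
      unfolding vert_def using dy cell_vert_subset cell_set_subset_Cube by blast
    have vne: "vert W \<noteq> {}" unfolding vert_def using fW(2) corner_in_cell_vert by blast
    have fV: "finite (vert W)" by (rule finite_vert(1)[OF fW(1)])
    obtain u where u: "\<mu> = comb (vert W) u"
      using measures_on_finite_eq_comb[OF _ fV] primal unfolding primal_solution_def by blast
    note opt = dual_solution_eq_gradient[OF cont f_convex f_grad fV subset_refl vC vne primal[unfolded u] dual]
    have qQ: "norm q \<le> Q"
      using Q0[OF fV subset_refl vC primal[unfolded u]] opt(1) by (simp add: Q_def)
    have edge_e: "edge \<omega> \<le> e" if "\<omega> \<in> C" for \<omega>
      using bspec[OF level that] by (simp add: edge_def e_def field_simps)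
    have viol: "\<bar>A_adj a q x\<bar> \<le> 1 + C2 * e\<^sup>2" if "x \<in> Cube" for x
      unfolding C2_def
    proof (rule dual_violation_bound[of a B q Q C, OF a_C2 bd _ B(4) qQ cover])
      show "\<bar>A_adj a q (corner \<omega>)\<bar> \<le> 1" if "\<omega> \<in> C" for \<omega>
        using opt(3) corner_in_cell_vert CW that unfolding vert_def by blast
    qed (use B(1) CW dy edge_e that in auto)
    \<comment> \<open>the violation bound turns the gap between the problems on vertices and on the cube into order \<open>e^2\<close>\<close>
    have gap: "objective a f \<mu> - objective a f (comb X w) + (norm (q - q0))\<^sup>2 / (2 * L') \<le> C2 * e\<^sup>2 * T"
      unfolding T_def
      by (rule duality_gap_bound[OF cont f_convex f_grad L'(2,1) X star(1) _ _ viol])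
        (use opt u in auto)
    have "comb (vert W) u \<in> measures_on Cube" by (rule comb_measures_on[OF fV vC])
    then have opt_star: "objective a f (comb X w) \<le> objective a f \<mu>"
      using pstar unfolding w primal_solution_def u by blast
    have obj: "objective a f \<mu> - objective a f (dirac_comb S \<alpha> xs) \<le> K / 2 ^ (2 * j)"
    proof -
      have "0 \<le> (norm (q - q0))\<^sup>2 / (2 * L')" using L'(1) by simp
      then have "objective a f \<mu> - objective a f (comb X w) \<le> (C2 * T) * e\<^sup>2" using gap by (simp add: mult_ac)
      also have "\<dots> \<le> K * e\<^sup>2" using C1 by (intro mult_right_mono) (auto simp: K_def)
      finally show ?thesis by (simp add: w e_def power_one_over power_mult[symmetric] mult.commute)
    qed
    have dq: "norm (q - q0) \<le> C1 * e"
    proof (rule power2_le_imp_le)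
      have "(norm (q - q0))\<^sup>2 / (2 * L') \<le> C2 * e\<^sup>2 * T" using gap opt_star by linarith
      then have "(norm (q - q0))\<^sup>2 \<le> 2 * L' * (C2 * T) * e\<^sup>2" using L'(1) by (simp add: field_simps)
      also have "\<dots> = (C1 * e)\<^sup>2" using C2 T L'(1) by (simp add: C1_def power_mult_distrib)
      finally show "(norm (q - q0))\<^sup>2 \<le> (C1 * e)\<^sup>2" .
    qed (use C1 e in simp)
    also have "\<dots> \<le> K * e" using C2 T e by (intro mult_right_mono) (auto simp: K_def)
    finally have norm_q: "norm (q - q0) \<le> K / 2 ^ j" by (simp add: e_def)
    have BC: "B * (C1 * e) \<le> D * e" using D(3) e by (simp add: mult.assoc[symmetric])
    have small: "B * (C1 * e) \<le> \<gamma> / 2" using BC De(2) by linarith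
    have near: "\<exists>p\<in>P. \<exists>x\<in>cell_set \<omega>. norm (x - p) \<le> U / 2 ^ j" if \<omega>: "\<omega> \<in> C" for \<omega>
    proof -
      have dyw: "dyadic_cell \<omega>" using \<omega> CW dy by blast
      obtain x where x: "x \<in> cell_set \<omega>" "1 - \<kappa> * (edge \<omega>)\<^sup>2 \<le> \<bar>A_adj a q x\<bar>"
        using sup_norm_cell_attained[OF continuous_on_A_adj[OF cont] dyw bspec[OF cand \<omega>]] by blast
      have xC: "x \<in> Cube" using x(1) cell_set_subset_Cube[OF dyw] by blast
      have "(edge \<omega>)\<^sup>2 \<le> e\<^sup>2" using edge_e[OF \<omega>] edge_pos[of \<omega>] by (intro power_mono) auto
      then have "\<kappa> * (edge \<omega>)\<^sup>2 \<le> \<kappa> * e\<^sup>2" using kappa_pos by simp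
      then have gx: "1 - \<kappa> * e\<^sup>2 \<le> \<bar>A_adj a q x\<bar>" using x(2) by linarith
      have "\<bar>A_adj a q x - A_adj a q0 x\<bar> \<le> B * norm (q - q0)"
        using B(2)[OF xC, of "q - q0"] by (simp add: A_adj_diff)
      also have "\<dots> \<le> B * (C1 * e)" using dq B(1) by simp
      finally have dist: "\<bar>A_adj a q x - A_adj a q0 x\<bar> \<le> B * (C1 * e)" .
      have "\<kappa> * e\<^sup>2 + B * (C1 * e) \<le> \<kappa> * e + B * (C1 * e)" using e1 kappa_pos by simp
      also have "\<dots> < D * e" using e by (simp add: D_def algebra_simps)
      finally have tot: "\<kappa> * e\<^sup>2 + B * (C1 * e) < D * e" .
      have "0 \<le> B * (C1 * e)" "0 \<le> \<kappa> * e\<^sup>2" using B(1) C1 e kappa_pos by auto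
      note sm = this tot De
      \<comment> \<open>the limiting certificate is nearly 1 at \<open>x\<close>, hence there is a peak nearby, where both certificates have the same sign\<close>
      have "1 - \<delta> < \<bar>A_adj a q0 x\<bar>" using sm dist gx \<gamma>(3) by linarith
      then obtain p where p: "p \<in> P" "norm (x - p) < r" using off xC by blast
      have pC: "p \<in> Cube" and \<sigma>: "\<bar>A_adj a q0 p\<bar> = 1" using p(1) by (auto simp: P_def)
      have "\<bar>A_adj a q x - A_adj a q0 p\<bar> < 1" using peak(1)[OF p(1) xC p(2)] dist sm by linarith
      then have "A_adj a q0 p * A_adj a q x = \<bar>A_adj a q x\<bar>" using \<sigma> by (auto simp: abs_if split: if_splits)
      then have at_x: "1 - \<kappa> * e\<^sup>2 \<le> A_adj a q0 p * A_adj a q x" using gx by simp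
      have g0: "grad Cube (A_adj a q0) p = 0"
        by (rule grad_A_adj_at_extremum[of a, OF diff bd pC]) (use \<sigma> star(3) in auto)
      have "norm (x - p) \<le> (1 + 4 * (\<kappa> + C2 + B * C1) / \<gamma>) * e"
        by (rule near_peak[of a B, OF a_C2 _ B(3,4) pC g0 \<sigma> peak(2)[OF p(1)] xC p(2) dq _ viol[OF pC] at_x])
          (use B(1) small \<gamma>(1) e C1 C2 kappa_pos in auto)
      then show ?thesis using x(1) p(1) by (auto simp: U_def e_def)
    qed
    show "norm (q - q0) \<le> K / 2 ^ j \<and>
        objective a f \<mu> - objective a f (dirac_comb S \<alpha> xs) \<le> K / 2 ^ (2 * j) \<and>
        (\<forall>\<omega>\<in>C. \<exists>p\<in>P. \<exists>x\<in>cell_set \<omega>. norm (x - p) \<le> U / 2 ^ j)"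
      using norm_q obj near by blast
  qed
qed

theorem theorem7:
  fixes a :: "'m::finite \<Rightarrow> real ^ 'd::finite \<Rightarrow> real"
    and f :: "real ^ 'm \<Rightarrow> real"
    and gradf :: "real ^ 'm \<Rightarrow> real ^ 'm"
    and L \<kappa> :: real
    and S :: nat
    and \<alpha> :: "nat \<Rightarrow> real"
    and xstar :: "nat \<Rightarrow> real ^ 'd"
    and qstar :: "real ^ 'm"
  assumes a_C2: "\<And>m. C2_on Cube (a m)"
    and a_boundary: "\<And>m x. x \<in> frontier Cube \<Longrightarrow> a m x = 0"
    and f_convex: "convex_on UNIV f"
    and f_grad: "\<And>y. GDERIV f y :> gradf y"
    and f_lipschitz: "L-lipschitz_on UNIV gradf"
    and coercive: "coercive_objective a f"
    and source: "nondegenerate_source_condition a f S \<alpha> xstar qstar"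
    and kappa_pos: "\<kappa> > 0"
  shows "\<exists>k0::nat. \<exists>c::real. c > 0 \<and>
    (\<forall>\<Omega> C \<mu> q. adaptive_run a f \<Omega> C \<mu> q \<longrightarrow> admissible_candidates a \<kappa> C q \<longrightarrow>
      (\<forall>J. \<exists>k. terminates_at C J k \<and> real k \<le> real k0 + c * real S * real J) \<and>
      (\<exists>J0::nat. \<exists>K::real. \<forall>J\<ge>J0. \<forall>k. terminates_at C J k \<longrightarrow>
         real (card (vert (\<Omega> k))) \<le> K * real J \<and>
         dist_H (xstar ` {1..S}) (vert (C k)) \<le> ereal (K / 2 ^ J) \<and>
         norm (q k - qstar) \<le> K / 2 ^ J \<and>
         objective a f (\<mu> k) - objective a f (dirac_comb S \<alpha> xstar) \<le> K / 2 ^ (2 * J)))"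
proof -
  have bd: "\<forall>m. \<forall>x\<in>frontier Cube. a m x = 0" using a_boundary by blast
  obtain j0 K U P where PX: "P \<subseteq> xstar ` {1..S}" and K: "0 \<le> K" and U: "0 \<le> U"
    and est: "\<forall>W C \<mu> q j. nonoverlapping W \<longrightarrow> C \<subseteq> W \<longrightarrow>
       primal_solution a f (vert W) \<mu> \<longrightarrow> dual_solution a f (vert W) q \<longrightarrow>
       big_local_maximizers (A_adj a q) \<subseteq> (\<Union>\<omega>\<in>C. cell_set \<omega>) \<longrightarrow>
       (\<forall>\<omega>\<in>C. 1 - \<kappa> * (edge \<omega>)\<^sup>2 \<le> sup_norm (cell_set \<omega>) (A_adj a q)) \<longrightarrow>
       j0 \<le> j \<longrightarrow> (\<forall>\<omega>\<in>C. j \<le> fst \<omega>) \<longrightarrow>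
       norm (q - qstar) \<le> K / 2 ^ j \<and>
       objective a f \<mu> - objective a f (dirac_comb S \<alpha> xstar) \<le> K / 2 ^ (2 * j) \<and>
       (\<forall>\<omega>\<in>C. \<exists>p\<in>P. \<exists>x\<in>cell_set \<omega>. norm (x - p) \<le> U / 2 ^ j)"
    using estimates_at_resolution[OF a_C2 bd f_convex f_grad f_lipschitz coercive source kappa_pos]
    by (elim exE conjE) (rule that)
  have P: "finite P" "card P \<le> S"
    using PX finite_subset surj_card_le[of "{1..S}" P xstar] by auto
  define N0 where "N0 = card {\<omega> :: 'd cell. dyadic_cell \<omega> \<and> fst \<omega> < j0}"
  define M where "M = (nat \<lfloor>2 * (U + 1)\<rfloor> + 1) ^ CARD('d)"
  have M: "M > 0" by (simp add: M_def)
  have "(\<forall>J. \<exists>k. terminates_at C J k \<and> real k \<le> real (N0 + M * S) + real M * real S * real J) \<and>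
      (\<exists>J0::nat. \<exists>K::real. \<forall>J\<ge>J0. \<forall>k. terminates_at C J k \<longrightarrow>
         real (card (vert (\<Omega> k))) \<le> K * real J \<and>
         dist_H (xstar ` {1..S}) (vert (C k)) \<le> ereal (K / 2 ^ J) \<and>
         norm (q k - qstar) \<le> K / 2 ^ J \<and>
         objective a f (\<mu> k) - objective a f (dirac_comb S \<alpha> xstar) \<le> K / 2 ^ (2 * J))"
    if run: "adaptive_run a f \<Omega> C \<mu> q" and adm: "admissible_candidates a \<kappa> C q" for \<Omega> C \<mu> q
  proof -
    have init: "cell_partition (\<Omega> 0)" and sub: "\<And>k. C k \<subseteq> \<Omega> k"
      and step: "\<And>k. \<Omega> (Suc k) = refine (\<Omega> k) (C k)"
      and primal: "\<And>k. primal_solution a f (vert (\<Omega> k)) (\<mu> k)"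
      and dual: "\<And>k. dual_solution a f (vert (\<Omega> k)) (q k)"
      using run unfolding adaptive_run_def by blast+
    have non: "nonoverlapping (\<Omega> k)" for k by (rule nonoverlapping_iterates[of \<Omega> C, OF init sub step])
    have cover: "big_local_maximizers (A_adj a (q k)) \<subseteq> (\<Union>\<omega>\<in>C k. cell_set \<omega>)"
      and cand: "\<forall>\<omega>\<in>C k. 1 - \<kappa> * (edge \<omega>)\<^sup>2 \<le> sup_norm (cell_set \<omega>) (A_adj a (q k))" for k
      using adm unfolding admissible_candidates_def by blast+
    have est_k: "norm (q k - qstar) \<le> K / 2 ^ j \<and>
        objective a f (\<mu> k) - objective a f (dirac_comb S \<alpha> xstar) \<le> K / 2 ^ (2 * j) \<and>
        (\<forall>\<omega>\<in>C k. \<exists>p\<in>P. \<exists>x\<in>cell_set \<omega>. norm (x - p) \<le> U / 2 ^ j)"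
      if "j0 \<le> j" "\<forall>\<omega>\<in>C k. j \<le> fst \<omega>" for j k
      by (rule est[rule_format, OF non sub primal dual cover cand[rule_format]]) (use that in auto)
    have near: "\<exists>p\<in>P. \<exists>x\<in>cell_set \<omega>. norm (x - p) \<le> U / 2 ^ fst \<omega>"
      if \<omega>: "\<omega> \<in> largest_cells (C k)" and j: "j0 \<le> fst \<omega>" for k \<omega>
    proof -
      have "\<omega> \<in> C k" "\<forall>\<omega>'\<in>C k. fst \<omega> \<le> fst \<omega>'" using \<omega> by (auto simp: largest_cells_eq)
      then show ?thesis using est_k[OF j] by blast
    qed
    have count: "card (\<Union>i<k. largest_cells (C i)) \<le> N0 + M * S * (J + 1)"
      and steps: "k \<le> card (\<Union>i<k. largest_cells (C i))"
      if nostop: "\<And>i. i < k \<Longrightarrow> \<not> stops C J i" for J k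
    proof -
      have "card (\<Union>i<k. largest_cells (C i)) \<le> N0 + M * card P * (J + 1)"
        unfolding N0_def M_def
        by (rule card_refined_cells_le(1)[of \<Omega> C, OF init sub step P(1) near nostop])
      also have "\<dots> \<le> N0 + M * S * (J + 1)" using P(2) by (intro add_mono mult_mono) auto
      finally show "card (\<Union>i<k. largest_cells (C i)) \<le> N0 + M * S * (J + 1)" .
      show "k \<le> card (\<Union>i<k. largest_cells (C i))"
        by (rule card_refined_cells_le(2)[of \<Omega> C, OF init sub step P(1) near nostop])
    qed
    have terminates: "\<exists>k. terminates_at C J k \<and> real k \<le> real (N0 + M * S) + real M * real S * real J" for J
    proof -
      have ex: "\<exists>i. stops C J i"
      proof (rule ccontr)
        assume "\<nexists>i. stops C J i"
        then have never: "\<not> stops C J i" for i by blast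
        let ?n = "Suc (N0 + M * S * (J + 1))"
        have "?n \<le> N0 + M * S * (J + 1)"
          by (rule order_trans[OF steps count]) (rule never)+
        then show False by simp
      qed
      \<comment> \<open>\<open>terminates_at\<close> asks for the first index at which the criterion is met\<close>
      define k where "k = (LEAST i. stops C J i)"
      have k: "stops C J k" and min: "\<And>i. i < k \<Longrightarrow> \<not> stops C J i"
        unfolding k_def by (rule LeastI_ex[OF ex], rule not_less_Least)
      have "k \<le> N0 + M * S * (J + 1)" by (rule order_trans[OF steps count]) (rule min, assumption)+
      then have "real k \<le> real (N0 + M * S * (J + 1))" by (simp only: of_nat_le_iff)
      then have "real k \<le> real (N0 + M * S) + real M * real S * real J" by (simp add: algebra_simps)
      then show ?thesis using k min unfolding terminates_at_def by blast
    qed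
    \<comment> \<open>as \<open>J \<ge> 1\<close>, the terms that do not depend on \<open>J\<close> are absorbed into the linear one\<close>
    define Kv where "Kv = 2 ^ CARD('d) * (card (\<Omega> 0) + 2 ^ CARD('d) * (N0 + 2 * (M * S)))"
    define K' where "K' = real Kv + (U + real CARD('d)) + K"
    have "real (card (vert (\<Omega> k))) \<le> K' * real J \<and>
         dist_H (xstar ` {1..S}) (vert (C k)) \<le> ereal (K' / 2 ^ J) \<and>
         norm (q k - qstar) \<le> K' / 2 ^ J \<and>
         objective a f (\<mu> k) - objective a f (dirac_comb S \<alpha> xstar) \<le> K' / 2 ^ (2 * J)"
      if J: "max j0 1 \<le> J" and tm: "terminates_at C J k" for J k
    proof -
      have J0: "j0 \<le> J" and J1: "1 \<le> J" using J by auto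
      have stop: "stops C J k" and nostop: "\<And>i. i < k \<Longrightarrow> \<not> stops C J i"
        using tm by (auto simp: terminates_at_def)
      have fine: "\<forall>\<omega>\<in>C k. J \<le> fst \<omega>"
      proof
        fix \<omega> assume "\<omega> \<in> C k"
        then have "edge \<omega> < 1 / 2 ^ J" using stop by (auto simp: stops_def)
        then have "(2::real) ^ J < 2 ^ fst \<omega>" by (simp add: edge_def field_simps)
        then show "J \<le> fst \<omega>" by simp
      qed
      note E = est_k[OF J0 fine]
      have le: "K / 2 ^ n \<le> K' / 2 ^ n" for n
        using U by (intro divide_right_mono) (auto simp: K'_def)
      have "card (vert (\<Omega> k)) \<le> 2 ^ CARD('d) * card (\<Omega> k)"
        using non[of k] by (intro finite_vert) (simp add: nonoverlapping_def)
      also have "\<dots> \<le> 2 ^ CARD('d) * (card (\<Omega> 0) + 2 ^ CARD('d) * card (\<Union>i<k. largest_cells (C i)))"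
        by (intro mult_le_mono2 card_iterate_le[of \<Omega> C, OF init sub step])
      also have "\<dots> \<le> 2 ^ CARD('d) * (card (\<Omega> 0) * J + 2 ^ CARD('d) * ((N0 + 2 * (M * S)) * J))"
      proof (intro mult_le_mono2 add_mono)
        show "card (\<Omega> 0) \<le> card (\<Omega> 0) * J" using J1 by simp
        have "card (\<Union>i<k. largest_cells (C i)) \<le> N0 + M * S * (J + 1)"
          by (rule count) (rule nostop)
        also have "\<dots> \<le> N0 * J + M * S * (2 * J)"
          using J1 by (intro add_mono mult_le_mono2) auto
        finally show "card (\<Union>i<k. largest_cells (C i)) \<le> (N0 + 2 * (M * S)) * J"
          by (simp add: algebra_simps)
      qed
      also have "\<dots> = Kv * J" by (simp add: Kv_def algebra_simps)
      finally have "real (card (vert (\<Omega> k))) \<le> real Kv * real J"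
        unfolding of_nat_mult[symmetric] by (simp only: of_nat_le_iff)
      also have "\<dots> \<le> K' * real J" using U K by (intro mult_right_mono) (auto simp: K'_def)
      finally have verts: "real (card (vert (\<Omega> k))) \<le> K' * real J" .
      have "dist_H (xstar ` {1..S}) (vert (C k)) \<le> ereal (K' / 2 ^ J)"
        unfolding dist_H_def
      proof (rule SUP_least)
        fix v assume "v \<in> vert (C k)"
        then obtain \<omega> where \<omega>: "\<omega> \<in> C k" "v \<in> cell_set \<omega>"
          unfolding vert_def using cell_vert_subset by blast
        obtain p x where p: "p \<in> P" "x \<in> cell_set \<omega>" "norm (x - p) \<le> U / 2 ^ J" using E \<omega>(1) by blast
        have "edge \<omega> \<le> 1 / 2 ^ J" using stop \<omega>(1) by (auto simp: stops_def intro: less_imp_le)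
        then have "real CARD('d) * edge \<omega> \<le> real CARD('d) * (1 / 2 ^ J)" by (rule mult_left_mono) simp
        then have "norm (x - v) \<le> real CARD('d) / 2 ^ J"
          using norm_le_of_mem_cell_set[OF p(2) \<omega>(2)] by simp
        moreover have "norm (p - v) \<le> norm (x - p) + norm (x - v)"
          using norm_triangle_ineq4[of "x - v" "x - p"] by simp
        ultimately have "norm (p - v) \<le> (U + real CARD('d)) / 2 ^ J"
          using p(3) by (simp add: add_divide_distrib)
        also have "\<dots> \<le> K' / 2 ^ J" using K by (intro divide_right_mono) (auto simp: K'_def)
        finally show "(INF x1\<in>xstar ` {1..S}. ereal (norm (x1 - v))) \<le> ereal (K' / 2 ^ J)"
          using p(1) PX by (intro INF_lower2[of p]) auto
      qed
      then show ?thesis using verts E le[of J] le[of "2 * J"] by force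
    qed
    then show ?thesis using terminates by blast
  qed
  then show ?thesis using M by (intro exI[of _ "N0 + M * S"] exI[of _ "real M"]) auto
qed

end
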